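(* Let $(S,\mathcal F,\mathcal L)$ be a $p$-local finite group. Then $(S,\mathcal F,\mathcal L)$ is nilpotent if and only if $S$ controls fusion of $\mathcal C_p$-subgroups in $\mathcal F$, i.e. for every $\mathcal C_p$-subgroup $P\le S$ and every $f\in\mathrm{Hom}_{\mathcal F}(P,S)$ there exists $s\in S$ with $f(x)=sxs^{-1}$ for all $x\in P$.
   Context: An element $x\in S$ is a $\mathcal C_p$-element if $x^p=1$ when $p$ is odd, or $x^4=1$ when $p=2$; a $\mathcal C_p$-subgroup is a subgroup generated by a single $\mathcal C_p$-element. Let $S$ be a finite $p$-group. For $P,Q\le S$, $\mathrm{Hom}_S(P,Q)$ is the set of maps $c_g\colon x\mapsto gxg^{-1}$ with $g\in S$, $gPg^{-1}\le Q$, and $\mathrm{Aut}_S(P)=\mathrm{Hom}_S(P,P)$. A fusion system $\mathcal F$ over $S$ is a category whose objects are the subgroups of $S$, with $\mathrm{Hom}_S(P,Q)\subseteq\mathrm{Hom}_{\mathcal F}(P,Q)\subseteq \mathrm{Inj}(P,Q)$, such that every morphism factors as an $\mathcal F$-isomorphism followed by an inclusion. Subgroups are $\mathcal F$-conjugate if they are isomorphic in $\mathcal F$. $P$ is fully centralized (resp. fully normalized) if $|C_S(P)|\ge |C_S(P')|$ (resp. $|N_S(P)|\ge|N_S(P')|$) for all $P'$ $\mathcal F$-conjugate to $P$. $\mathcal F$ is saturated if (I) every fully normalized $P$ is fully centralized and $\mathrm{Aut}_S(P)$ is a Sylow $p$-subgroup of $\mathrm{Aut}_{\mathcal F}(P)$,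 and (II) whenever $\phi\in\mathrm{Hom}_{\mathcal F}(P,S)$ with $\phi(P)$ fully centralized, $\phi$ extends to a morphism in $\mathcal F$ defined on $N_\phi=\{g\in N_S(P):\phi c_g\phi^{-1}\in \mathrm{Aut}_S(\phi(P))\}$. $P$ is $\mathcal F$-centric if $C_S(P')\le P'$ for all $P'$ $\mathcal F$-conjugate to $P$; $\mathcal F^c$ is the full subcategory on these. A centric linking system associated to $\mathcal F$ is a category $\mathcal L$ with objects the $\mathcal F$-centric subgroups, a functor $\pi\colon\mathcal L\to\mathcal F^c$ which is the identity on objects, and monomorphisms $\delta_P\colon P\to\mathrm{Aut}_{\mathcal L}(P)$, such that (A) $Z(P)$ (via $\delta_P$) acts freely on $\mathrm{Mor}_{\mathcal L}(P,Q)$ by composition and $\pi$ induces a bijection $\mathrm{Mor}_{\mathcal L}(P,Q)/Z(P)\to\mathrm{Hom}_{\mathcal F}(P,Q)$; (B) $\pi(\delta_P(g))=c_g$ for $g\in P$; (C) $f\circ\delta_P(g)=\delta_Q(\pi(f)(g))\circ f$ for $f\in\mathrm{Mor}_{\mathcal L}(P,Q)$, $g\in P$. A $p$-local finite group is a triple $(S,\mathcal F,\mathcal L)$ with $\mathcal F$ a saturated fusion system over $S$ and $\mathcal L$ an associated centric linking system. $(S,\mathcal F,\mathcal L)$ is called nilpotent if $\mathcal F=\mathcal F_S(S)$, the fusion system with $\mathrm{Hom}_{\mathcal F_S(S)}(P,Q)=\mathrm{Hom}_S(P,Q)$. *)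

theory Defs
  imports "HOL-Algebra.Algebra" "HOL-Library.FuncSet" "HOL-Computational_Algebra.Primes"
begin

definition p_group :: "('a, 'b) monoid_scheme \<Rightarrow> nat \<Rightarrow> bool" where
  "p_group S p \<longleftrightarrow> group S \<and> finite (carrier S) \<and> Factorial_Ring.prime p \<and> (\<exists>n. card (carrier S) = p ^ n)"

definition centralizer_in :: "('a, 'b) monoid_scheme \<Rightarrow> 'a set \<Rightarrow> 'a set" where
  "centralizer_in S P = {g \<in> carrier S. \<forall>x\<in>P. g \<otimes>\<^bsub>S\<^esub> x = x \<otimes>\<^bsub>S\<^esub> g}"

definition center_of :: "('a, 'b) monoid_scheme \<Rightarrow> 'a set \<Rightarrow> 'a set" where
  "center_of S P = P \<inter> centralizer_in S P"

text \<open>c_g restricted to P (morphisms are extensional functions on their domain).\<close>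
definition conj_map :: "('a, 'b) monoid_scheme \<Rightarrow> 'a \<Rightarrow> 'a set \<Rightarrow> ('a \<Rightarrow> 'a)" where
  "conj_map S g P = (\<lambda>x\<in>P. g \<otimes>\<^bsub>S\<^esub> x \<otimes>\<^bsub>S\<^esub> inv\<^bsub>S\<^esub> g)"

definition HomS :: "('a, 'b) monoid_scheme \<Rightarrow> 'a set \<Rightarrow> 'a set \<Rightarrow> ('a \<Rightarrow> 'a) set" where
  "HomS S P Q = {conj_map S g P | g. g \<in> carrier S \<and>
                   (\<lambda>x. g \<otimes>\<^bsub>S\<^esub> x \<otimes>\<^bsub>S\<^esub> inv\<^bsub>S\<^esub> g) ` P \<subseteq> Q}"

definition Inj_hom :: "('a, 'b) monoid_scheme \<Rightarrow> 'a set \<Rightarrow> 'a set \<Rightarrow> ('a \<Rightarrow> 'a) set" where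
  "Inj_hom S P Q = {\<phi>. \<phi> \<in> extensional P \<and> \<phi> ` P \<subseteq> Q \<and> inj_on \<phi> P \<and>
                     (\<forall>x\<in>P. \<forall>y\<in>P. \<phi> (x \<otimes>\<^bsub>S\<^esub> y) = \<phi> x \<otimes>\<^bsub>S\<^esub> \<phi> y)}"

text \<open>A fusion system over S is given by its hom-sets F P Q (meaningful for subgroups P, Q of S).
  Morphisms are extensional functions on P, composition is function composition.\<close>

definition fusion_system :: "('a, 'b) monoid_scheme \<Rightarrow> ('a set \<Rightarrow> 'a set \<Rightarrow> ('a \<Rightarrow> 'a) set) \<Rightarrow> bool" where
  "fusion_system S F \<longleftrightarrow>
     (\<forall>P Q. subgroup P S \<longrightarrow> subgroup Q S \<longrightarrow> HomS S P Q \<subseteq> F P Q \<and> F P Q \<subseteq> Inj_hom S P Q)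
   \<and> (\<forall>P. subgroup P S \<longrightarrow> (\<lambda>x\<in>P. x) \<in> F P P)
   \<and> (\<forall>P Q R \<phi> \<psi>. subgroup P S \<longrightarrow> subgroup Q S \<longrightarrow> subgroup R S \<longrightarrow>
        \<phi> \<in> F P Q \<longrightarrow> \<psi> \<in> F Q R \<longrightarrow> compose P \<psi> \<phi> \<in> F P R)
   \<and> (\<forall>P Q \<phi>. subgroup P S \<longrightarrow> subgroup Q S \<longrightarrow> \<phi> \<in> F P Q \<longrightarrow>
        \<phi> \<in> F P (\<phi> ` P) \<and> (\<lambda>y\<in>\<phi> ` P. the_inv_into P \<phi> y) \<in> F (\<phi> ` P) P)"

definition F_iso :: "('a set \<Rightarrow> 'a set \<Rightarrow> ('a \<Rightarrow> 'a) set) \<Rightarrow> 'a set \<Rightarrow> 'a set \<Rightarrow> bool" where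
  "F_iso F P Q \<longleftrightarrow> (\<exists>\<phi>\<in>F P Q. \<exists>\<psi>\<in>F Q P.
      compose P \<psi> \<phi> = (\<lambda>x\<in>P. x) \<and> compose Q \<phi> \<psi> = (\<lambda>x\<in>Q. x))"

definition F_conjugate :: "('a, 'b) monoid_scheme \<Rightarrow> ('a set \<Rightarrow> 'a set \<Rightarrow> ('a \<Rightarrow> 'a) set) \<Rightarrow> 'a set \<Rightarrow> 'a set \<Rightarrow> bool" where
  "F_conjugate S F P Q \<longleftrightarrow> subgroup P S \<and> subgroup Q S \<and> F_iso F P Q"

definition fully_centralized :: "('a, 'b) monoid_scheme \<Rightarrow> ('a set \<Rightarrow> 'a set \<Rightarrow> ('a \<Rightarrow> 'a) set) \<Rightarrow> 'a set \<Rightarrow> bool" where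
  "fully_centralized S F P \<longleftrightarrow>
     (\<forall>P'. F_conjugate S F P P' \<longrightarrow> card (centralizer_in S P') \<le> card (centralizer_in S P))"

definition fully_normalized :: "('a, 'b) monoid_scheme \<Rightarrow> ('a set \<Rightarrow> 'a set \<Rightarrow> ('a \<Rightarrow> 'a) set) \<Rightarrow> 'a set \<Rightarrow> bool" where
  "fully_normalized S F P \<longleftrightarrow>
     (\<forall>P'. F_conjugate S F P P' \<longrightarrow> card (normalizer S P') \<le> card (normalizer S P))"

definition AutF_group :: "('a set \<Rightarrow> 'a set \<Rightarrow> ('a \<Rightarrow> 'a) set) \<Rightarrow> 'a set \<Rightarrow> ('a \<Rightarrow> 'a) monoid" where
  "AutF_group F P = \<lparr>carrier = F P P, monoid.mult = compose P, monoid.one = (\<lambda>x\<in>P. x)\<rparr>"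

definition sylow_subgroup :: "nat \<Rightarrow> 'c set \<Rightarrow> ('c, 'd) monoid_scheme \<Rightarrow> bool" where
  "sylow_subgroup p H G \<longleftrightarrow> subgroup H G \<and> card H = p ^ multiplicity p (card (carrier G))"

text \<open>N_phi = {g in N_S(P) : phi c_g phi^-1 in Aut_S(phi(P))}, written out pointwise.\<close>
definition N_phi :: "('a, 'b) monoid_scheme \<Rightarrow> 'a set \<Rightarrow> ('a \<Rightarrow> 'a) \<Rightarrow> 'a set" where
  "N_phi S P \<phi> = {g \<in> normalizer S P. \<exists>h \<in> normalizer S (\<phi> ` P).
       \<forall>x\<in>P. \<phi> (g \<otimes>\<^bsub>S\<^esub> x \<otimes>\<^bsub>S\<^esub> inv\<^bsub>S\<^esub> g) = h \<otimes>\<^bsub>S\<^esub> \<phi> x \<otimes>\<^bsub>S\<^esub> inv\<^bsub>S\<^esub> h}"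

definition saturated :: "('a, 'b) monoid_scheme \<Rightarrow> nat \<Rightarrow> ('a set \<Rightarrow> 'a set \<Rightarrow> ('a \<Rightarrow> 'a) set) \<Rightarrow> bool" where
  "saturated S p F \<longleftrightarrow> fusion_system S F
   \<and> (\<forall>P. subgroup P S \<longrightarrow> fully_normalized S F P \<longrightarrow>
         fully_centralized S F P \<and> sylow_subgroup p (HomS S P P) (AutF_group F P))
   \<and> (\<forall>P \<phi>. subgroup P S \<longrightarrow> \<phi> \<in> F P (carrier S) \<longrightarrow> fully_centralized S F (\<phi> ` P) \<longrightarrow>
         (\<exists>\<psi> \<in> F (N_phi S P \<phi>) (carrier S). \<forall>x\<in>P. \<psi> x = \<phi> x))"

definition F_centric :: "('a, 'b) monoid_scheme \<Rightarrow> ('a set \<Rightarrow> 'a set \<Rightarrow> ('a \<Rightarrow> 'a) set) \<Rightarrow> 'a set \<Rightarrow> bool" where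
  "F_centric S F P \<longleftrightarrow> subgroup P S \<and>
     (\<forall>P'. F_conjugate S F P P' \<longrightarrow> centralizer_in S P' \<subseteq> P')"

text \<open>A category L with objects the F-centric subgroups: morphism sets Mor P Q, composition
  cmp g f (g after f), identities idL P; the functor pi (on morphisms, indexed by source and
  target), and the monomorphisms delta_P : P -> Aut_L(P).\<close>

definition linking_system ::
  "('a, 'b) monoid_scheme \<Rightarrow> ('a set \<Rightarrow> 'a set \<Rightarrow> ('a \<Rightarrow> 'a) set) \<Rightarrow>
   ('a set \<Rightarrow> 'a set \<Rightarrow> 'm set) \<Rightarrow> ('m \<Rightarrow> 'm \<Rightarrow> 'm) \<Rightarrow> ('a set \<Rightarrow> 'm) \<Rightarrow>
   ('a set \<Rightarrow> 'a set \<Rightarrow> 'm \<Rightarrow> ('a \<Rightarrow> 'a)) \<Rightarrow> ('a set \<Rightarrow> 'a \<Rightarrow> 'm) \<Rightarrow> bool" where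
  "linking_system S F Mor cmp idL \<pi> \<delta> \<longleftrightarrow>
     \<comment> \<open>L is a category on the F-centric subgroups\<close>
     (\<forall>P Q R f g. F_centric S F P \<longrightarrow> F_centric S F Q \<longrightarrow> F_centric S F R \<longrightarrow>
         f \<in> Mor P Q \<longrightarrow> g \<in> Mor Q R \<longrightarrow> cmp g f \<in> Mor P R)
   \<and> (\<forall>P Q R T f g h. F_centric S F P \<longrightarrow> F_centric S F Q \<longrightarrow> F_centric S F R \<longrightarrow> F_centric S F T \<longrightarrow>
         f \<in> Mor P Q \<longrightarrow> g \<in> Mor Q R \<longrightarrow> h \<in> Mor R T \<longrightarrow> cmp h (cmp g f) = cmp (cmp h g) f)
   \<and> (\<forall>P. F_centric S F P \<longrightarrow> idL P \<in> Mor P P)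
   \<and> (\<forall>P Q f. F_centric S F P \<longrightarrow> F_centric S F Q \<longrightarrow> f \<in> Mor P Q \<longrightarrow>
         cmp f (idL P) = f \<and> cmp (idL Q) f = f)
     \<comment> \<open>pi is a functor L -> F^c, identity on objects\<close>
   \<and> (\<forall>P Q f. F_centric S F P \<longrightarrow> F_centric S F Q \<longrightarrow> f \<in> Mor P Q \<longrightarrow> \<pi> P Q f \<in> F P Q)
   \<and> (\<forall>P Q R f g. F_centric S F P \<longrightarrow> F_centric S F Q \<longrightarrow> F_centric S F R \<longrightarrow>
         f \<in> Mor P Q \<longrightarrow> g \<in> Mor Q R \<longrightarrow> \<pi> P R (cmp g f) = compose P (\<pi> Q R g) (\<pi> P Q f))
   \<and> (\<forall>P. F_centric S F P \<longrightarrow> \<pi> P P (idL P) = (\<lambda>x\<in>P. x))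
     \<comment> \<open>delta_P is a monomorphism of groups P -> Aut_L(P)\<close>
   \<and> (\<forall>P. F_centric S F P \<longrightarrow>
         (\<forall>g\<in>P. \<delta> P g \<in> Mor P P)
       \<and> (\<forall>g\<in>P. \<forall>h\<in>P. \<delta> P (g \<otimes>\<^bsub>S\<^esub> h) = cmp (\<delta> P g) (\<delta> P h))
       \<and> \<delta> P \<one>\<^bsub>S\<^esub> = idL P
       \<and> inj_on (\<delta> P) P)
     \<comment> \<open>(A) Z(P) acts freely on Mor(P,Q), and pi induces a bijection Mor(P,Q)/Z(P) -> Hom_F(P,Q)\<close>
   \<and> (\<forall>P Q. F_centric S F P \<longrightarrow> F_centric S F Q \<longrightarrow>
         (\<forall>f\<in>Mor P Q. \<forall>z\<in>center_of S P. cmp f (\<delta> P z) = f \<longrightarrow> z = \<one>\<^bsub>S\<^esub>)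
       \<and> (\<forall>f\<in>Mor P Q. \<forall>f'\<in>Mor P Q. \<pi> P Q f = \<pi> P Q f' \<longleftrightarrow>
              (\<exists>z\<in>center_of S P. f' = cmp f (\<delta> P z)))
       \<and> F P Q \<subseteq> \<pi> P Q ` Mor P Q)
     \<comment> \<open>(B)\<close>
   \<and> (\<forall>P. F_centric S F P \<longrightarrow> (\<forall>g\<in>P. \<pi> P P (\<delta> P g) = conj_map S g P))
     \<comment> \<open>(C)\<close>
   \<and> (\<forall>P Q f g. F_centric S F P \<longrightarrow> F_centric S F Q \<longrightarrow> f \<in> Mor P Q \<longrightarrow> g \<in> P \<longrightarrow>
         cmp f (\<delta> P g) = cmp (\<delta> Q (\<pi> P Q f g)) f)"

definition p_local_finite_group ::
  "('a, 'b) monoid_scheme \<Rightarrow> nat \<Rightarrow> ('a set \<Rightarrow> 'a set \<Rightarrow> ('a \<Rightarrow> 'a) set) \<Rightarrow>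
   ('a set \<Rightarrow> 'a set \<Rightarrow> 'm set) \<Rightarrow> ('m \<Rightarrow> 'm \<Rightarrow> 'm) \<Rightarrow> ('a set \<Rightarrow> 'm) \<Rightarrow>
   ('a set \<Rightarrow> 'a set \<Rightarrow> 'm \<Rightarrow> ('a \<Rightarrow> 'a)) \<Rightarrow> ('a set \<Rightarrow> 'a \<Rightarrow> 'm) \<Rightarrow> bool" where
  "p_local_finite_group S p F Mor cmp idL \<pi> \<delta> \<longleftrightarrow>
     p_group S p \<and> saturated S p F \<and> linking_system S F Mor cmp idL \<pi> \<delta>"

definition nilpotent_fusion :: "('a, 'b) monoid_scheme \<Rightarrow> ('a set \<Rightarrow> 'a set \<Rightarrow> ('a \<Rightarrow> 'a) set) \<Rightarrow> bool" where
  "nilpotent_fusion S F \<longleftrightarrow> (\<forall>P Q. subgroup P S \<longrightarrow> subgroup Q S \<longrightarrow> F P Q = HomS S P Q)"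

definition Cp_element :: "('a, 'b) monoid_scheme \<Rightarrow> nat \<Rightarrow> 'a \<Rightarrow> bool" where
  "Cp_element S p x \<longleftrightarrow> x \<in> carrier S \<and>
     (if p = 2 then x [^]\<^bsub>S\<^esub> (4::nat) = \<one>\<^bsub>S\<^esub> else x [^]\<^bsub>S\<^esub> p = \<one>\<^bsub>S\<^esub>)"

definition Cp_subgroup :: "('a, 'b) monoid_scheme \<Rightarrow> nat \<Rightarrow> 'a set \<Rightarrow> bool" where
  "Cp_subgroup S p P \<longleftrightarrow> (\<exists>x. Cp_element S p x \<and> P = generate S {x})"

definition controls_Cp_fusion :: "('a, 'b) monoid_scheme \<Rightarrow> nat \<Rightarrow> ('a set \<Rightarrow> 'a set \<Rightarrow> ('a \<Rightarrow> 'a) set) \<Rightarrow> bool" where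
  "controls_Cp_fusion S p F \<longleftrightarrow>
     (\<forall>P. Cp_subgroup S p P \<longrightarrow> (\<forall>f \<in> F P (carrier S).
        \<exists>s \<in> carrier S. \<forall>x\<in>P. f x = s \<otimes>\<^bsub>S\<^esub> x \<otimes>\<^bsub>S\<^esub> inv\<^bsub>S\<^esub> s))"

end

theory Submission
  imports Defs
begin

text \<open>
  Let \<open>\<alpha>\<close> be an \<open>F\<close>-automorphism of \<open>P\<close> of order prime to \<open>p\<close>, and let \<open>Q\<close> be an \<open>\<alpha>\<close>-invariant
  subgroup of \<open>P\<close>, minimal among those on which \<open>\<alpha>\<close> is not the identity. As in Thompson's
  theory of critical subgroups, every element of \<open>Q\<close> is a \<open>C\<^sub>p\<close>-element. Choose \<open>N\<close> normal
  in \<open>S\<close> with \<open>\<not> Q \<subseteq> N\<close> and \<open>[S,Q] \<subseteq> N\<close>. Since \<open>\<alpha>\<close> acts on each element of \<open>Q\<close> as some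
  conjugation in \<open>S\<close>, it preserves \<open>Q \<inter> N\<close> and is trivial on \<open>Q / (Q \<inter> N)\<close>; by minimality it
  is trivial on \<open>Q \<inter> N\<close>, and coprimality makes it trivial on \<open>Q\<close>, a contradiction.

  Hence all groups \<open>Aut\<^sub>F(P)\<close> are \<open>p\<close>-groups, so \<open>Aut\<^sub>F(P) = Aut\<^sub>S(P)\<close> for fully normalized \<open>P\<close>.
  A morphism onto a fully normalized subgroup then extends to \<open>N\<^sub>S(P)\<close>, and induction on the
  index of \<open>P\<close> shows that every morphism is a conjugation.
\<close>

section \<open>Finite p-groups\<close>

locale finite_p_group = group G for G (structure) +
  fixes p :: nat
  assumes p_group: "p_group G p"
begin

section \<open>Central elements and elements of order p\<close>

lemma prime_p: "Factorial_Ring.prime p"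
  and finite_carrier: "finite (carrier G)"
  and order_eq_power: "\<exists>n. order G = p ^ n"
  using p_group by (auto simp: p_group_def order_def)

lemma dvd_p_power:
  assumes "d dvd order G"
  shows "\<exists>i. d = p ^ i"
proof -
  obtain n where "order G = p ^ n" using order_eq_power by blast
  with assms divides_primepow_nat[OF prime_p] show ?thesis by auto
qed

text \<open>Class equation. Conjugacy classes have p-power size, and the identity forms a class of
  size one. Without another central element every other class would have size divisible by p, so the
  order would be 1 modulo p.\<close>

lemma nontrivial_center:
  assumes "order G \<noteq> 1"
  obtains z where "z \<in> carrier G" "z \<noteq> \<one>" "\<And>s. s \<in> carrier G \<Longrightarrow> s \<otimes> z = z \<otimes> s"
proof (rule ccontr)
  assume no: "\<not> thesis"
  note obtained = that
  let ?\<phi> = "\<lambda>g. \<lambda>h\<in>carrier G. g \<otimes> h \<otimes> inv g"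
  interpret act: group_action G "carrier G" ?\<phi> by (rule action_by_conjugation)
  let ?O = "orbits G (carrier G) ?\<phi>"
  have one: "orbit G ?\<phi> \<one> = {\<one>}"
    unfolding orbit_def by (auto intro: exI[of _ \<one>])
  have inO: "{\<one>} \<in> ?O" using one by (auto simp: orbits_def)
  have finO: "finite ?O"
    using finite_carrier by (auto simp: orbits_def)
  have "p dvd card C" if CO: "C \<in> ?O - {{\<one>}}" for C
  proof -
    obtain x where x: "x \<in> carrier G" and C: "C = orbit G ?\<phi> x"
      using DiffD1[OF CO] unfolding orbits_def by (elim CollectE exE conjE)
    have "card C dvd order G"
      unfolding C by (rule dvdI[OF act.orbit_stabilizer_theorem[OF x, symmetric]])
    then obtain i where i: "card C = p ^ i" using dvd_p_power by blast
    have "card C \<noteq> 1"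
    proof
      assume "card C = 1"
      moreover have "x \<in> C" using act.orbit_refl[OF x] C by simp
      ultimately have Xx: "C = {x}" by (metis card_1_singletonE singletonD)
      have "s \<otimes> x = x \<otimes> s" if s: "s \<in> carrier G" for s
      proof -
        have "s \<otimes> x \<otimes> inv s \<in> C" unfolding C orbit_def using s x by auto
        then have "s \<otimes> x \<otimes> inv s = x" using Xx by blast
        then show ?thesis using s x inv_solve_right'[of x "s \<otimes> x" s] by simp
      qed
      moreover have "x \<noteq> \<one>" using CO Xx by auto
      ultimately show False using no x obtained[of x] by blast
    qed
    then show ?thesis using i by (cases i) auto
  qed
  then have "p dvd (\<Sum>C\<in>?O - {{\<one>}}. card C)" by (rule dvd_sum)
  moreover have "order G = (\<Sum>C\<in>?O. card C)"
    using act.disjoint_sum[OF finite_carrier, of "\<lambda>_. 1::nat"] by (simp add: order_def)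
  then have "order G = 1 + (\<Sum>C\<in>?O - {{\<one>}}. card C)"
    using sum.remove[OF finO inO, of card] by simp
  moreover obtain n where n: "order G = p ^ n" using order_eq_power by blast
  then have "p dvd order G"
    using assms by (cases n) auto
  ultimately have "p dvd 1" using dvd_diff_nat[of p "order G" "\<Sum>C\<in>?O - {{\<one>}}. card C"] by simp
  then show False using prime_p by simp
qed

text \<open>With j least such that z to the power p^j is trivial, k = p^(j-1) works. The element of
  order p is taken as a power of \<open>z\<close> so that it stays central when \<open>z\<close>
  is.\<close>

lemma power_p_chain:
  assumes "z \<in> carrier G" "z \<noteq> \<one>"
  obtains k :: nat where "z [^] k \<noteq> \<one>" "(z [^] k) [^] p = \<one>"
proof -
  obtain n where n: "order G = p ^ n" using order_eq_power by blast
  have "z [^] (p ^ n) = \<one>" using pow_order_eq_1 assms n by metis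
  then have ex: "\<exists>j. z [^] (p ^ j) = \<one>" by blast
  define j where "j = (LEAST j. z [^] (p ^ j) = \<one>)"
  have j: "z [^] (p ^ j) = \<one>" using ex unfolding j_def by (rule LeastI_ex)
  have "j \<noteq> 0"
  proof
    assume "j = 0"
    with j assms show False by simp
  qed
  then obtain i where i: "j = Suc i" by (cases j) auto
  have "i < (LEAST j. z [^] (p ^ j) = \<one>)" using i by (simp only: j_def[symmetric] lessI)
  then have "z [^] (p ^ i) \<noteq> \<one>" by (rule not_less_Least)
  moreover have "(z [^] (p ^ i)) [^] p = \<one>"
    using j i assms by (simp add: nat_pow_pow mult.commute)
  ultimately show thesis using that by blast
qed

section \<open>Central factors of exponent p\<close>

lemma FactGroup_finite_p_group:
  assumes N: "N \<lhd> G"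
  shows "finite_p_group (G Mod N) p"
proof -
  interpret N: normal N G by (rule N)
  have "card (carrier (G Mod N)) * card N = order G"
    using lagrange[OF N.subgroup_axioms] by (simp add: FactGroup_def)
  then have "card (carrier (G Mod N)) dvd order G" by (metis dvd_triv_left)
  moreover have "finite (carrier (G Mod N))"
    using finite_carrier by (simp add: FactGroup_def RCOSETS_def)
  ultimately have "p_group (G Mod N) p"
    using dvd_p_power prime_p N.factorgroup_is_group by (simp add: p_group_def)
  then show ?thesis
    by (simp add: finite_p_group_def finite_p_group_axioms_def N.factorgroup_is_group)
qed

end

text \<open>One step of an ascending central series whose factors have exponent p. Phrasing it for a
  surjection \<open>h\<close> rather than for a quotient keeps coset arithmetic out of the
  computations.\<close>

lemma (in group_hom) central_exponent_p_preimage: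
  assumes "finite_p_group H p" and ne: "order H \<noteq> 1" and surj: "h ` carrier G = carrier H"
  obtains M where "M \<lhd> G" "kernel G H h \<subset> M" "\<And>w. w \<in> M \<Longrightarrow> w [^] p \<in> kernel G H h"
    "\<And>w s. w \<in> M \<Longrightarrow> s \<in> carrier G \<Longrightarrow> s \<otimes> w \<otimes> inv s \<otimes> inv w \<in> kernel G H h"
proof -
  interpret Q: finite_p_group H p by (rule assms(1))
  obtain z0 where z0: "z0 \<in> carrier H" "z0 \<noteq> \<one>\<^bsub>H\<^esub>"
    and cen0: "\<And>s. s \<in> carrier H \<Longrightarrow> s \<otimes>\<^bsub>H\<^esub> z0 = z0 \<otimes>\<^bsub>H\<^esub> s"
    using Q.nontrivial_center[OF ne] by blast
  obtain k where k: "z0 [^]\<^bsub>H\<^esub> (k::nat) \<noteq> \<one>\<^bsub>H\<^esub>" "(z0 [^]\<^bsub>H\<^esub> k) [^]\<^bsub>H\<^esub> p = \<one>\<^bsub>H\<^esub>"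
    using Q.power_p_chain[OF z0] by blast
  have cenk: "s \<otimes>\<^bsub>H\<^esub> (z0 [^]\<^bsub>H\<^esub> k) = (z0 [^]\<^bsub>H\<^esub> k) \<otimes>\<^bsub>H\<^esub> s"
    if "s \<in> carrier H" for s
    using H.group_commutes_pow[of z0 s k] that z0 cen0 by simp
  obtain z where z: "z \<in> carrier G" "h z = z0 [^]\<^bsub>H\<^esub> k"
    using surj z0 H.nat_pow_closed[of z0 k] by (metis imageE)
  \<comment> \<open>\<open>M\<close> is the preimage of the subgroup of the center of
    \<open>H\<close> formed by the elements with trivial p-th power. It is larger than the kernel
    because it contains \<open>z\<close>, whose image is central of order p.\<close>
  define M where "M = {w \<in> carrier G. h w [^]\<^bsub>H\<^esub> p = \<one>\<^bsub>H\<^esub> \<and>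
    (\<forall>s\<in>carrier H. s \<otimes>\<^bsub>H\<^esub> h w = h w \<otimes>\<^bsub>H\<^esub> s)}"
  have MG: "w \<in> carrier G" and Mp: "h w [^]\<^bsub>H\<^esub> p = \<one>\<^bsub>H\<^esub>" if "w \<in> M" for w
    using that by (auto simp: M_def)
  have Mc: "s \<otimes>\<^bsub>H\<^esub> h w = h w \<otimes>\<^bsub>H\<^esub> s" if "w \<in> M" "s \<in> carrier H" for w s
    using that by (auto simp: M_def)
  have MI: "w \<in> M" if "w \<in> carrier G" "h w [^]\<^bsub>H\<^esub> p = \<one>\<^bsub>H\<^esub>"
    "\<And>s. s \<in> carrier H \<Longrightarrow> s \<otimes>\<^bsub>H\<^esub> h w = h w \<otimes>\<^bsub>H\<^esub> s" for w
    using that by (auto simp: M_def)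
  have conj: "h (s \<otimes> w \<otimes> inv s) = h w" if "w \<in> M" "s \<in> carrier G" for w s
    using that MG[of w] Mc[of w "h s"] by (simp add: H.m_assoc)
  have "subgroup M G"
  proof
    show "M \<subseteq> carrier G" using MG by blast
    show "\<one> \<in> M" by (rule MI) simp_all
    show "x \<otimes> y \<in> M" if "x \<in> M" "y \<in> M" for x y
    proof -
      have xy: "x \<in> carrier G" "y \<in> carrier G" using that MG by auto
      have "(h x \<otimes>\<^bsub>H\<^esub> h y) [^]\<^bsub>H\<^esub> p = \<one>\<^bsub>H\<^esub>"
        using H.pow_mult_distrib[of "h x" "h y" p] Mc[OF that(2), of "h x"] Mp that xy by simp
      moreover have "s \<otimes>\<^bsub>H\<^esub> (h x \<otimes>\<^bsub>H\<^esub> h y) = (h x \<otimes>\<^bsub>H\<^esub> h y) \<otimes>\<^bsub>H\<^esub> s"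
        if s: "s \<in> carrier H" for s
      proof -
        have "s \<otimes>\<^bsub>H\<^esub> (h x \<otimes>\<^bsub>H\<^esub> h y) = (h x \<otimes>\<^bsub>H\<^esub> s) \<otimes>\<^bsub>H\<^esub> h y"
          using s xy Mc[OF \<open>x \<in> M\<close> s] by (simp add: H.m_assoc[symmetric])
        also have "\<dots> = (h x \<otimes>\<^bsub>H\<^esub> h y) \<otimes>\<^bsub>H\<^esub> s"
          using s xy Mc[OF \<open>y \<in> M\<close> s] by (simp add: H.m_assoc)
        finally show ?thesis .
      qed
      ultimately show ?thesis using xy by (intro MI) auto
    qed
    show "inv x \<in> M" if "x \<in> M" for x
    proof -
      have x: "x \<in> carrier G" using that MG by auto
      have "(inv\<^bsub>H\<^esub> h x) [^]\<^bsub>H\<^esub> p = \<one>\<^bsub>H\<^esub>"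
        using that x Mp by (simp add: H.nat_pow_inv)
      moreover have "s \<otimes>\<^bsub>H\<^esub> inv\<^bsub>H\<^esub> h x = inv\<^bsub>H\<^esub> h x \<otimes>\<^bsub>H\<^esub> s"
        if s: "s \<in> carrier H" for s
      proof -
        have "h x \<otimes>\<^bsub>H\<^esub> (s \<otimes>\<^bsub>H\<^esub> inv\<^bsub>H\<^esub> h x) = (s \<otimes>\<^bsub>H\<^esub> h x) \<otimes>\<^bsub>H\<^esub> inv\<^bsub>H\<^esub> h x"
          using s x Mc[OF \<open>x \<in> M\<close> s] by (simp add: H.m_assoc[symmetric])
        also have "\<dots> = s" using s x by (simp add: H.m_assoc)
        finally show ?thesis using s x H.inv_solve_left[of "s \<otimes>\<^bsub>H\<^esub> inv\<^bsub>H\<^esub> h x" "h x" s] by simp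
      qed
      ultimately show ?thesis using x by (intro MI) auto
    qed
  qed
  moreover have "s \<otimes> w \<otimes> inv s \<in> M" if "s \<in> carrier G" "w \<in> M" for s w
    using conj[OF that(2,1)] that MG Mp Mc by (intro MI) simp_all
  ultimately have "M \<lhd> G" by (simp add: G.normal_inv_iff)
  moreover have "kernel G H h \<subset> M"
  proof
    show "kernel G H h \<subseteq> M" by (auto simp: kernel_def intro!: MI)
    have "z \<in> M" using z k cenk by (intro MI) simp_all
    moreover have "z \<notin> kernel G H h" using z k by (simp add: kernel_def)
    ultimately show "kernel G H h \<noteq> M" by blast
  qed
  moreover have "w [^] p \<in> kernel G H h" if "w \<in> M" for w
    using MG Mp that by (simp add: kernel_def hom_nat_pow)
  moreover have "s \<otimes> w \<otimes> inv s \<otimes> inv w \<in> kernel G H h" if "w \<in> M" "s \<in> carrier G" for w s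
  proof -
    have w: "w \<in> carrier G" using that MG by simp
    have "h (s \<otimes> w \<otimes> inv s \<otimes> inv w) = h (s \<otimes> w \<otimes> inv s) \<otimes>\<^bsub>H\<^esub> inv\<^bsub>H\<^esub> h w"
      using that w by (simp only: hom_mult hom_inv G.m_closed G.inv_closed)
    then show ?thesis using conj[OF that] w that by (simp add: kernel_def)
  qed
  ultimately show thesis using that by blast
qed

context finite_p_group begin

lemma finite_normal_sets: "finite {N. N \<lhd> G}"
  by (rule finite_subset[of _ "Pow (carrier G)"])
    (auto simp: finite_carrier dest: normal_imp_subgroup subgroup.subset)

text \<open>The preceding lemma for the projection onto \<open>G Mod N\<close>, whose kernel is
  \<open>N\<close>; the quotient is nontrivial because \<open>N\<close> is proper.\<close>

lemma central_extension_step: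
  assumes N: "N \<lhd> G" and ne: "N \<noteq> carrier G"
  obtains M where "M \<lhd> G" "N \<subset> M" "\<And>w. w \<in> M \<Longrightarrow> w [^] p \<in> N"
    "\<And>w s. w \<in> M \<Longrightarrow> s \<in> carrier G \<Longrightarrow> s \<otimes> w \<otimes> inv s \<otimes> inv w \<in> N"
proof -
  interpret N: normal N G by (rule N)
  let ?h = "\<lambda>x. N #> x"
  have ker: "kernel G (G Mod N) ?h = N"
    using coset_join1[OF _ _ N.subgroup_axioms] coset_join2[OF _ N.subgroup_axioms]
      N.subset by (auto simp: kernel_def)
  have surj: "?h ` carrier G = carrier (G Mod N)"
    by (auto simp: FactGroup_def RCOSETS_def)
  interpret h: group_hom G "G Mod N" ?h
    by (simp add: group_hom_def group_hom_axioms_def N.r_coset_hom_Mod N.factorgroup_is_group)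
  have "order (G Mod N) \<noteq> 1"
  proof
    assume "order (G Mod N) = 1"
    then obtain a where "carrier (G Mod N) = {a}" by (auto simp: order_def card_1_singleton_iff)
    then have "?h x = \<one>\<^bsub>G Mod N\<^esub>" if "x \<in> carrier G" for x
      using h.hom_closed[OF that] h.H.one_closed by (metis singletonD)
    then have "carrier G \<subseteq> kernel G (G Mod N) ?h" by (auto simp: kernel_def)
    then show False using ker ne N.subset by blast
  qed
  then show thesis
    using h.central_exponent_p_preimage[OF FactGroup_finite_p_group[OF N] _ surj] that ker by metis
qed

text \<open>Take \<open>N\<close> maximal among the normal subgroups not containing
  \<open>Q\<close>. The central extension \<open>M\<close> of \<open>N\<close> is strictly larger,
  hence contains \<open>Q\<close>, and its commutator and power conditions pass to
  \<open>Q\<close>.\<close>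

lemma central_quotient_below:
  assumes Q: "subgroup Q G" and ne: "Q \<noteq> {\<one>}"
  obtains N where "N \<lhd> G" "\<not> Q \<subseteq> N" "\<And>w. w \<in> Q \<Longrightarrow> w [^] p \<in> N"
    "\<And>w s. w \<in> Q \<Longrightarrow> s \<in> carrier G \<Longrightarrow> s \<otimes> w \<otimes> inv s \<otimes> inv w \<in> N"
proof -
  let ?A = "{N. N \<lhd> G \<and> \<not> Q \<subseteq> N}"
  have "finite ?A" using finite_normal_sets by (rule rev_finite_subset) auto
  moreover have "{\<one>} \<in> ?A"
    using one_is_normal ne subgroup.one_closed[OF Q] by auto
  ultimately have "\<exists>N\<in>?A. \<forall>M\<in>?A. N \<subseteq> M \<longrightarrow> N = M"
    by (intro finite_has_maximal) auto
  then obtain N where N: "N \<in> ?A" and max: "\<forall>M\<in>?A. N \<subseteq> M \<longrightarrow> N = M"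
    by (rule bexE)
  have ne': "N \<noteq> carrier G" using N subgroup.subset[OF Q] by blast
  obtain M where M: "M \<lhd> G" "N \<subset> M" "\<And>w. w \<in> M \<Longrightarrow> w [^] p \<in> N"
    "\<And>w s. w \<in> M \<Longrightarrow> s \<in> carrier G \<Longrightarrow> s \<otimes> w \<otimes> inv s \<otimes> inv w \<in> N"
    by (rule central_extension_step[OF _ ne']) (use N in blast)+
  have "Q \<subseteq> M" using max M(1,2) by blast
  then show thesis using that[of N] N M(3,4) by blast
qed

section \<open>Growth of normalizers\<close>

lemma mem_normalizer_iff:
  assumes P: "subgroup P G"
  shows "g \<in> normalizer G P \<longleftrightarrow> g \<in> carrier G \<and> (\<lambda>x. g \<otimes> x \<otimes> inv g) ` P = P"
proof -
  have "g <# P #> inv g = (\<lambda>x. g \<otimes> x \<otimes> inv g) ` P" by (auto simp: l_coset_def r_coset_def)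
  then show ?thesis using subgroup.subset[OF P]
    by (auto simp: normalizer_def stabilizer_def)
qed

lemma conj_image_eqI:
  assumes P: "subgroup P G" and g: "g \<in> carrier G"
    and sub: "\<And>x. x \<in> P \<Longrightarrow> g \<otimes> x \<otimes> inv g \<in> P"
  shows "(\<lambda>x. g \<otimes> x \<otimes> inv g) ` P = P"
proof (rule card_subset_eq)
  have "P \<subseteq> carrier G" using subgroup.subset[OF P] .
  show "finite P" using \<open>P \<subseteq> carrier G\<close> finite_carrier finite_subset by blast
  show "(\<lambda>x. g \<otimes> x \<otimes> inv g) ` P \<subseteq> P" using sub by blast
  have "inj_on (\<lambda>x. g \<otimes> x \<otimes> inv g) P"
    using conjugation_is_inj[OF g] \<open>P \<subseteq> carrier G\<close> by (intro inj_onI) blast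
  then show "card ((\<lambda>x. g \<otimes> x \<otimes> inv g) ` P) = card P" by (rule card_image)
qed

text \<open>Let \<open>N\<close> be a maximal normal subgroup of \<open>G\<close> inside
  \<open>P\<close>, and \<open>M\<close> a central extension of \<open>N\<close> as above. By
  maximality \<open>M\<close> is not inside \<open>P\<close>, and every element of \<open>M\<close>
  normalizes \<open>P\<close>, since its commutators with \<open>P\<close> lie in \<open>N\<close>
  and so in \<open>P\<close>.\<close>

lemma subgroup_psubset_normalizer:
  assumes P: "subgroup P G" and ne: "P \<noteq> carrier G"
  shows "P \<subset> normalizer G P"
proof -
  have PG: "P \<subseteq> carrier G" using subgroup.subset[OF P] .
  let ?A = "{N. N \<lhd> G \<and> N \<subseteq> P}"
  have "finite ?A" using finite_normal_sets by (rule rev_finite_subset) auto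
  moreover have "{\<one>} \<in> ?A"
    using one_is_normal subgroup.one_closed[OF P] by auto
  ultimately have "\<exists>N\<in>?A. \<forall>M\<in>?A. N \<subseteq> M \<longrightarrow> N = M"
    by (intro finite_has_maximal) auto
  then obtain N where N: "N \<in> ?A" and max: "\<forall>M\<in>?A. N \<subseteq> M \<longrightarrow> N = M"
    by (rule bexE)
  have ne': "N \<noteq> carrier G" using N ne PG by blast
  obtain M where M: "M \<lhd> G" "N \<subset> M"
    "\<And>w s. w \<in> M \<Longrightarrow> s \<in> carrier G \<Longrightarrow> s \<otimes> w \<otimes> inv s \<otimes> inv w \<in> N"
    by (rule central_extension_step[OF _ ne']) (use N in blast)+
  have "\<not> M \<subseteq> P" using max M(1,2) by blast
  then obtain g where g: "g \<in> M" "g \<notin> P" by blast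
  have gG: "g \<in> carrier G" using g M(1) normal_imp_subgroup subgroup.subset by blast
  have "g \<in> normalizer G P"
  proof -
    have "g \<otimes> x \<otimes> inv g \<in> P" if x: "x \<in> P" for x
    proof -
      have xG: "x \<in> carrier G" using x PG by blast
      have "x \<otimes> g \<otimes> inv x \<otimes> inv g \<in> P" using M(3)[OF g(1) xG] N by blast
      \<comment> \<open>The conjugate of x by g is x multiplied by a commutator from
        \<open>N\<close>.\<close>
      then have "inv (x \<otimes> g \<otimes> inv x \<otimes> inv g) \<otimes> x \<in> P"
        using x P by (simp add: subgroup.m_closed subgroup.m_inv_closed)
      also have "inv (x \<otimes> g \<otimes> inv x \<otimes> inv g) \<otimes> x = g \<otimes> x \<otimes> inv g"
        using xG gG by (simp add: inv_mult_group m_assoc)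
      finally show ?thesis .
    qed
    then show ?thesis using mem_normalizer_iff[OF P] conj_image_eqI[OF P gG] gG by blast
  qed
  moreover have "P \<subseteq> normalizer G P"
  proof
    fix x assume x: "x \<in> P"
    then have "x \<otimes> y \<otimes> inv x \<in> P" if "y \<in> P" for y
      using that P by (simp add: subgroup.m_closed subgroup.m_inv_closed)
    then show "x \<in> normalizer G P"
      using mem_normalizer_iff[OF P] conj_image_eqI[OF P, of x] x PG by blast
  qed
  ultimately show ?thesis using g by blast
qed

end

section \<open>Automorphisms of order prime to p\<close>

text \<open>Collection in class two. Moving x to the left past k factors y produces k copies of the
  central c; collecting the k-th power of xy adds 0 + 1 + ... + (k-1) copies, that is k choose
  2.\<close>

lemma (in group) pow_mult_central_commutator:
  fixes k :: nat
  assumes [simp]: "x \<in> carrier G" "y \<in> carrier G" "c \<in> carrier G"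
    and yx: "y \<otimes> x = x \<otimes> y \<otimes> c" and cx: "c \<otimes> x = x \<otimes> c" and cy: "c \<otimes> y = y \<otimes> c"
  shows pow_commute_central_commutator: "y [^] k \<otimes> x = x \<otimes> y [^] k \<otimes> c [^] k"
    and "(x \<otimes> y) [^] k = x [^] k \<otimes> y [^] k \<otimes> c [^] (k choose 2)"
proof -
  have ck: "c [^] i \<otimes> x = x \<otimes> c [^] i" "c [^] i \<otimes> y = y \<otimes> c [^] i" for i :: nat
    using group_commutes_pow[OF cx] group_commutes_pow[OF cy] by simp_all
  show *: "y [^] k \<otimes> x = x \<otimes> y [^] k \<otimes> c [^] k" for k :: nat
  proof (induction k)
    case (Suc k)
    have "y [^] Suc k \<otimes> x = y [^] k \<otimes> (y \<otimes> x)" by (simp add: m_assoc)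
    also have "\<dots> = (y [^] k \<otimes> x) \<otimes> (y \<otimes> c)" by (simp add: yx m_assoc)
    also have "\<dots> = x \<otimes> y [^] k \<otimes> (c [^] k \<otimes> y) \<otimes> c" by (simp add: Suc m_assoc)
    also have "\<dots> = x \<otimes> y [^] Suc k \<otimes> c [^] Suc k" by (simp add: ck m_assoc)
    finally show ?case .
  qed simp
  show "(x \<otimes> y) [^] k = x [^] k \<otimes> y [^] k \<otimes> c [^] (k choose 2)"
  proof (induction k)
    case (Suc k)
    let ?d = "c [^] (k choose 2)"
    have "(x \<otimes> y) [^] Suc k = x [^] k \<otimes> y [^] k \<otimes> (?d \<otimes> x) \<otimes> y" by (simp add: Suc m_assoc)
    also have "\<dots> = x [^] k \<otimes> (y [^] k \<otimes> x) \<otimes> (y \<otimes> ?d)" by (simp add: ck m_assoc)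
    also have "\<dots> = x [^] k \<otimes> x \<otimes> y [^] k \<otimes> (c [^] k \<otimes> y) \<otimes> ?d" by (simp add: * m_assoc)
    also have "\<dots> = x [^] Suc k \<otimes> y [^] Suc k \<otimes> (c [^] k \<otimes> ?d)" by (simp add: ck m_assoc)
    also have "c [^] k \<otimes> ?d = c [^] (Suc k choose 2)"
      by (simp add: nat_pow_mult numeral_2_eq_2)
    finally show ?case .
  qed (simp add: numeral_2_eq_2)
qed

section \<open>The exponent of C_p-elements\<close>

context finite_p_group begin

text \<open>Two properties of this number e are used: p divides e, and p divides e choose 2. The
  second fails for e = p = 2, which is where 4 comes from.\<close>

definition Cp_exponent :: nat where
  "Cp_exponent = (if p = 2 then 4 else p)"

lemma Cp_element_iff: "Cp_element G p x \<longleftrightarrow> x \<in> carrier G \<and> x [^] Cp_exponent = \<one>"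
  by (auto simp: Cp_element_def Cp_exponent_def)

lemma p_dvd_Cp_exponent: "p dvd Cp_exponent"
  by (auto simp: Cp_exponent_def)

lemma p_dvd_Cp_exponent_choose_2: "p dvd (Cp_exponent choose 2)"
proof (cases "p = 2")
  case True
  then show ?thesis unfolding Cp_exponent_def by (simp add: choose_two)
next
  case False
  then have "2 < p" using prime_ge_2_nat[OF prime_p] by linarith
  then have "odd p" by (rule prime_odd_nat[OF prime_p])
  then have "p choose 2 = p * ((p - 1) div 2)"
    using div_mult_swap[of 2 "p - 1" p] by (simp add: choose_two)
  then show ?thesis using False by (simp add: Cp_exponent_def)
qed

lemma pow_eq_one_coprimeD:
  assumes "c \<in> carrier G" "c [^] (n::nat) = \<one>" "coprime n p"
  shows "c = \<one>"
proof -
  obtain m where "order G = p ^ m" using order_eq_power by blast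
  then have "ord c dvd p ^ m" using ord_dvd_group_order assms(1) by metis
  moreover have "ord c dvd n" using assms pow_eq_id by blast
  moreover have "coprime n (p ^ m)" using assms(3) by simp
  ultimately have "ord c = 1" by (metis coprime_common_divisor_nat nat_dvd_1_iff_1 is_unit_gcd coprime_def)
  then show ?thesis using ord_eq_1 assms(1) by simp
qed

end

text \<open>\<alpha> is a bare function with a period on the points of \<open>P\<close>, so that it
  can be applied unchanged on every invariant subgroup. As n is prime to p it is nonzero, so
  \<alpha> is bijective on \<open>P\<close>.\<close>

locale coprime_endomorphism = finite_p_group +
  fixes P :: "'a set" and \<alpha> :: "'a \<Rightarrow> 'a" and n :: nat
  assumes P: "subgroup P G"
    and \<alpha>_mult: "\<And>x y. x \<in> P \<Longrightarrow> y \<in> P \<Longrightarrow> \<alpha> (x \<otimes> y) = \<alpha> x \<otimes> \<alpha> y"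
    and \<alpha>_closed: "\<And>x. x \<in> P \<Longrightarrow> \<alpha> x \<in> P"
    and \<alpha>_period: "\<And>x. x \<in> P \<Longrightarrow> (\<alpha> ^^ n) x = x"
    and coprime_n: "coprime n p"
begin

section \<open>Coprime action on a p-group\<close>

lemma P_carrier: "x \<in> P \<Longrightarrow> x \<in> carrier G"
  using subgroup.subset[OF P] by blast

lemma P_mult: "x \<in> P \<Longrightarrow> y \<in> P \<Longrightarrow> x \<otimes> y \<in> P"
  and P_inv: "x \<in> P \<Longrightarrow> inv x \<in> P"
  and P_one: "\<one> \<in> P"
  using P by (simp_all add: subgroup.m_closed subgroup.m_inv_closed subgroup.one_closed)

lemma P_pow: "x \<in> P \<Longrightarrow> x [^] (k::nat) \<in> P"
  by (induction k) (auto simp: P_mult P_one)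

lemma \<alpha>_one: "\<alpha> \<one> = \<one>"
  using \<alpha>_mult[OF P_one P_one] P_carrier[OF \<alpha>_closed[OF P_one]]
  by (metis l_one r_cancel_one' one_closed)

lemma \<alpha>_inv: "x \<in> P \<Longrightarrow> \<alpha> (inv x) = inv (\<alpha> x)"
  using \<alpha>_mult[of "inv x" x] by (simp add: P_inv \<alpha>_closed P_carrier \<alpha>_one inv_equality)

lemma \<alpha>_pow: "x \<in> P \<Longrightarrow> \<alpha> (x [^] (k::nat)) = \<alpha> x [^] k"
  by (induction k) (auto simp: \<alpha>_mult \<alpha>_one P_pow)

lemma iter_mult: "x \<in> P \<Longrightarrow> y \<in> P \<Longrightarrow> (\<alpha> ^^ k) (x \<otimes> y) = (\<alpha> ^^ k) x \<otimes> (\<alpha> ^^ k) y"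
  and iter_closed: "x \<in> P \<Longrightarrow> (\<alpha> ^^ k) x \<in> P"
proof -
  show cl: "x \<in> P \<Longrightarrow> (\<alpha> ^^ k) x \<in> P" for x k by (induction k) (auto simp: \<alpha>_closed)
  show "x \<in> P \<Longrightarrow> y \<in> P \<Longrightarrow> (\<alpha> ^^ k) (x \<otimes> y) = (\<alpha> ^^ k) x \<otimes> (\<alpha> ^^ k) y"
    by (induction k) (auto simp: \<alpha>_mult cl)
qed

lemma iter_inv: "x \<in> P \<Longrightarrow> (\<alpha> ^^ k) (inv x) = inv ((\<alpha> ^^ k) x)"
  by (induction k) (auto simp: \<alpha>_inv iter_closed)

lemma iter_one: "(\<alpha> ^^ k) \<one> = \<one>"
  by (induction k) (auto simp: \<alpha>_one)

lemma iter_pow: "x \<in> P \<Longrightarrow> (\<alpha> ^^ k) (x [^] (j::nat)) = (\<alpha> ^^ k) x [^] j"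
  by (induction j) (auto simp: iter_mult iter_one P_pow)

text \<open>If the displacement c is fixed, then iterating k times takes x to x times the k-th power
  of c. At k = n this gives a trivial n-th power of c, so c is trivial by coprimality. Consequently
  \<alpha> is trivial on a group once it is trivial on an invariant subgroup containing all
  displacements.\<close>

lemma fixed_if_displacement_fixed:
  assumes x: "x \<in> P" and fixed: "\<alpha> (inv x \<otimes> \<alpha> x) = inv x \<otimes> \<alpha> x"
  shows "\<alpha> x = x"
proof -
  define c where "c = inv x \<otimes> \<alpha> x"
  have c: "c \<in> P" using x by (simp add: c_def P_mult P_inv \<alpha>_closed)
  have \<alpha>x: "\<alpha> x = x \<otimes> c" using x by (simp add: c_def P_carrier \<alpha>_closed m_assoc[symmetric])
  have "(\<alpha> ^^ k) x = x \<otimes> c [^] k" for k :: nat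
  proof (induction k)
    case (Suc k)
    have "(\<alpha> ^^ Suc k) x = \<alpha> x \<otimes> c [^] k"
      using Suc x c fixed by (simp add: \<alpha>_mult \<alpha>_pow P_pow c_def[symmetric])
    also have "\<dots> = x \<otimes> c [^] Suc k"
      using x c nat_pow_Suc2[of c k] by (simp only: \<alpha>x) (simp add: P_carrier m_assoc)
    finally show ?case .
  qed (use x in \<open>simp add: P_carrier\<close>)
  then have "x \<otimes> c [^] n = x" using \<alpha>_period[OF x] by metis
  then have "c [^] n = \<one>" using x c by (simp add: P_carrier)
  then have "c = \<one>" using pow_eq_one_coprimeD c coprime_n P_carrier by blast
  then show ?thesis using \<alpha>x x by (simp add: P_carrier)
qed

text \<open>Strong induction on the size of an invariant subgroup \<open>Q\<close>. In a minimal
  counterexample, an invariant subgroup containing all displacements must be \<open>Q\<close>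
  itself. This is applied to the centralizer of \<open>R\<close> in \<open>Q\<close>, then to the
  C_p-elements of \<open>Q\<close>, and finally to the intersection with \<open>N\<close>.\<close>

lemma trivial_if_conj_on_Cp_elements:
  assumes conj: "\<And>x. x \<in> P \<Longrightarrow> Cp_element G p x \<Longrightarrow> \<exists>s\<in>carrier G. \<alpha> x = s \<otimes> x \<otimes> inv s"
    and x: "x \<in> P"
  shows "\<alpha> x = x"
proof -
  have "\<forall>x\<in>Q. \<alpha> x = x" if "subgroup Q G" "Q \<subseteq> P" "\<alpha> ` Q \<subseteq> Q" for Q
    using that
  proof (induction "card Q" arbitrary: Q rule: less_induct)
    case less
    interpret Q: subgroup Q G by (rule less.prems(1))
    have QP: "x \<in> P" if "x \<in> Q" for x using that less.prems by blast
    have \<alpha>Q: "\<alpha> x \<in> Q" if "x \<in> Q" for x using that less.prems by blast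
    have iterQ: "(\<alpha> ^^ k) x \<in> Q" if "x \<in> Q" for x k
      using that by (induction k) (auto simp: \<alpha>Q)
    have powQ: "x [^] (k::nat) \<in> Q" if "x \<in> Q" for x k
      using that by (induction k) auto
    have finQ: "finite Q" using Q.subset finite_carrier finite_subset by blast
    have fixQ: "\<alpha> r = r" if "subgroup R G" "R \<subset> Q" "\<alpha> ` R \<subseteq> R" "r \<in> R" for R r
      using less.hyps[of R] that less.prems psubset_card_mono[OF finQ] by blast
    have stab: "\<alpha> x = x" if "subgroup R G" "R \<subset> Q" "\<alpha> ` R \<subseteq> R" "x \<in> Q"
      "inv x \<otimes> \<alpha> x \<in> R" for R x
      using fixed_if_displacement_fixed[OF QP[OF that(4)]] fixQ[OF that(1,2,3,5)] by blast
    show ?case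
    proof (rule ccontr)
      assume nontriv: "\<not> ?case"
      \<comment> \<open>A proper \<open>R\<close> of this kind would be fixed pointwise by the
        induction hypothesis, and \<open>stab\<close> would then make \<alpha> trivial on all of
        \<open>Q\<close>.\<close>
      have absorb: "R = Q" if "subgroup R G" "R \<subseteq> Q" "\<alpha> ` R \<subseteq> R"
        "\<And>x. x \<in> Q \<Longrightarrow> inv x \<otimes> \<alpha> x \<in> R" for R
        using stab[of R] that nontriv by blast
      have "Q \<noteq> {\<one>}" using nontriv \<alpha>_one by auto
      then obtain N where N: "N \<lhd> G" and QN: "\<not> Q \<subseteq> N" and Npow: "\<And>w. w \<in> Q \<Longrightarrow> w [^] p \<in> N"
        and Ncomm: "\<And>w s. w \<in> Q \<Longrightarrow> s \<in> carrier G \<Longrightarrow> s \<otimes> w \<otimes> inv s \<otimes> inv w \<in> N"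
        using central_quotient_below[OF less.prems(1)] by metis
      interpret N: normal N G by (rule N)
      \<comment> \<open>Unlike \<open>Q \<inter> N\<close>, this is \<open>\<alpha>\<close>-invariant before \<open>Q\<close> is known to consist of \<open>C\<^sub>p\<close>-elements.\<close>
      define R where "R = {x \<in> Q. \<forall>k. (\<alpha> ^^ k) x \<in> N}"
      have R: "subgroup R G"
        by unfold_locales (auto simp: R_def iter_mult iter_inv iter_one QP)
      have RQ: "R \<subset> Q"
      proof -
        have "R \<subseteq> N" unfolding R_def by (auto dest: spec[of _ 0])
        then show ?thesis using QN R_def by blast
      qed
      have \<alpha>R: "\<alpha> ` R \<subseteq> R"
        by (auto simp: R_def \<alpha>Q funpow_swap1[symmetric] simp del: funpow.simps) (metis funpow_swap1 funpow.simps(2) comp_apply)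
      have fixR: "\<alpha> r = r" if "r \<in> R" for r using fixQ[OF R RQ \<alpha>R that] .
      \<comment> \<open>Iterates of p-th powers and commutators of elements of \<open>Q\<close> are
        again such elements, hence lie in \<open>N\<close>. So \<open>Q\<close> modulo
        \<open>R\<close> is elementary abelian.\<close>
      have powR: "x [^] p \<in> R" if "x \<in> Q" for x
        using that by (simp add: R_def powQ iter_pow QP Npow iterQ)
      have commR: "y \<otimes> x \<otimes> inv y \<otimes> inv x \<in> R" if "x \<in> Q" "y \<in> Q" for x y
        using that by (simp add: R_def iter_mult iter_inv QP P_mult P_inv Ncomm iterQ)
      have normR: "x \<otimes> r \<otimes> inv x \<in> R" if "x \<in> Q" "r \<in> R" for x r
        using that by (simp add: R_def iter_mult iter_inv QP P_mult P_inv N.inv_op_closed2 iterQ)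
      have RC: "r \<in> carrier G" if "r \<in> R" for r using subgroup.subset[OF R] that by blast
      have RinQ: "r \<in> Q" if "r \<in> R" for r using RQ that by blast
      \<comment> \<open>\<open>R\<close> is fixed pointwise and normal in \<open>Q\<close>. Applying
        \<alpha> to the conjugate of r by x, itself an element of \<open>R\<close>, shows that x and
        \<alpha> x conjugate r alike. Displacements therefore centralize \<open>R\<close>, and
        \<open>absorb\<close> applies to its centralizer \<open>C\<close>.\<close>
      have centralR: "x \<otimes> r = r \<otimes> x" if "x \<in> Q" "r \<in> R" for x r
      proof -
        define C where "C = {x \<in> Q. \<forall>r\<in>R. x \<otimes> r = r \<otimes> x}"
        have "subgroup C G"
        proof
          show "C \<subseteq> carrier G" by (auto simp: C_def)
          show "\<one> \<in> C" using RC by (auto simp: C_def)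
          show "x \<otimes> y \<in> C" if "x \<in> C" "y \<in> C" for x y
          proof -
            have "x \<otimes> y \<otimes> r = r \<otimes> (x \<otimes> y)" if r: "r \<in> R" for r
            proof -
              have "x \<otimes> y \<otimes> r = x \<otimes> (r \<otimes> y)"
                using \<open>x \<in> C\<close> \<open>y \<in> C\<close> r RC by (simp add: C_def m_assoc)
              also have "\<dots> = r \<otimes> x \<otimes> y"
                using \<open>x \<in> C\<close> \<open>y \<in> C\<close> r RC by (simp add: C_def m_assoc[symmetric])
              finally show ?thesis using \<open>x \<in> C\<close> \<open>y \<in> C\<close> r RC by (simp add: C_def m_assoc)
            qed
            then show ?thesis using that by (auto simp: C_def)
          qed
          show "inv x \<in> C" if "x \<in> C" for x
          proof -
            have "inv x \<otimes> r = r \<otimes> inv x" if r: "r \<in> R" for r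
            proof -
              have x: "x \<in> carrier G" using \<open>x \<in> C\<close> by (auto simp: C_def)
              have "x \<otimes> (r \<otimes> inv x) = (r \<otimes> x) \<otimes> inv x"
                using \<open>x \<in> C\<close> r RC x by (simp add: C_def m_assoc[symmetric])
              also have "\<dots> = r" using r RC x by (simp add: m_assoc)
              finally show ?thesis using inv_solve_left'[of "r \<otimes> inv x" x r] r RC x by simp
            qed
            then show ?thesis using that by (auto simp: C_def)
          qed
        qed
        moreover have "\<alpha> ` C \<subseteq> C"
        proof clarify
          fix x assume x: "x \<in> C"
          then have xQ: "x \<in> Q" by (simp add: C_def)
          have "\<alpha> x \<otimes> r = r \<otimes> \<alpha> x" if r: "r \<in> R" for r
          proof -
            have "\<alpha> x \<otimes> r = \<alpha> (x \<otimes> r)" "r \<otimes> \<alpha> x = \<alpha> (r \<otimes> x)"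
              using xQ r by (simp_all add: \<alpha>_mult QP RinQ fixR)
            moreover have "x \<otimes> r = r \<otimes> x" using x r by (simp add: C_def)
            ultimately show ?thesis by (simp only:)
          qed
          then show "\<alpha> x \<in> C" using x by (simp add: C_def \<alpha>Q)
        qed
        moreover have "inv x \<otimes> \<alpha> x \<in> C" if x: "x \<in> Q" for x
        proof -
          have [simp]: "x \<in> carrier G" "\<alpha> x \<in> carrier G" using x \<alpha>Q by auto
          have "inv x \<otimes> \<alpha> x \<otimes> r = r \<otimes> (inv x \<otimes> \<alpha> x)" if r: "r \<in> R" for r
          proof -
            have [simp]: "r \<in> carrier G" using RC r by blast
            have "x \<otimes> r \<otimes> inv x = \<alpha> (x \<otimes> r \<otimes> inv x)" using fixR[OF normR[OF x r]] by simp
            also have "\<dots> = \<alpha> x \<otimes> r \<otimes> inv (\<alpha> x)"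
              using x r by (simp add: \<alpha>_mult \<alpha>_inv QP P_mult P_inv RinQ fixR)
            finally have eq: "\<alpha> x \<otimes> r \<otimes> inv (\<alpha> x) = x \<otimes> r \<otimes> inv x" by simp
            have "inv x \<otimes> \<alpha> x \<otimes> r = inv x \<otimes> (\<alpha> x \<otimes> r \<otimes> inv (\<alpha> x)) \<otimes> \<alpha> x"
              by (simp add: m_assoc)
            also have "\<dots> = inv x \<otimes> (x \<otimes> r \<otimes> inv x) \<otimes> \<alpha> x" by (simp only: eq)
            also have "\<dots> = r \<otimes> (inv x \<otimes> \<alpha> x)" by (simp add: m_assoc[symmetric])
            finally show ?thesis .
          qed
          then show ?thesis using x \<alpha>Q by (simp add: C_def)
        qed
        ultimately have "C = Q" by (intro absorb) (auto simp: C_def)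
        then show ?thesis using that by (auto simp: C_def)
      qed
      \<comment> \<open>Commutators of \<open>Q\<close> lie in the central \<open>R\<close>, so the
        collection formula applies; its correction term disappears because p divides the binomial
        coefficient and c has trivial p-th power.\<close>
      have powe_mult: "(x \<otimes> y) [^] Cp_exponent = x [^] Cp_exponent \<otimes> y [^] Cp_exponent"
        if x: "x \<in> Q" and y: "y \<in> Q" for x y
      proof -
        define c where "c = inv y \<otimes> inv x \<otimes> y \<otimes> x"
        have [simp]: "x \<in> carrier G" "y \<in> carrier G" using x y by auto
        have cR: "c \<in> R" using commR[of "inv x" "inv y"] x y by (simp add: c_def)
        then have [simp]: "c \<in> carrier G" by (rule RC)
        have cancel: "a \<otimes> (inv a \<otimes> b) = b" if "a \<in> carrier G" "b \<in> carrier G" for a b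
          using that by (simp add: m_assoc[symmetric])
        have yx: "y \<otimes> x = x \<otimes> y \<otimes> c" by (simp add: c_def m_assoc cancel)
        have cx: "c \<otimes> x = x \<otimes> c" "c \<otimes> y = y \<otimes> c" using centralR[OF x cR] centralR[OF y cR] by simp_all
        \<comment> \<open>The p-th power of y lies in \<open>R\<close> and commutes with x, while
          moving x past it costs the p-th power of c.\<close>
        have "x \<otimes> y [^] p = x \<otimes> y [^] p \<otimes> c [^] p"
          using pow_commute_central_commutator[of x y c p] yx cx centralR[OF x powR[OF y]] by simp
        then have "c [^] p = \<one>" by simp
        moreover obtain j where "Cp_exponent choose 2 = p * j"
          using p_dvd_Cp_exponent_choose_2 by (elim dvdE)
        ultimately have "c [^] (Cp_exponent choose 2) = \<one>"
          using nat_pow_pow[of c p j] by simp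
        then show ?thesis
          using pow_mult_central_commutator(2)[of x y c Cp_exponent] yx cx by simp
      qed
      have poweR: "x [^] Cp_exponent \<in> R" if "x \<in> Q" for x
      proof -
        obtain j where "Cp_exponent = p * j"
          using p_dvd_Cp_exponent by (elim dvdE)
        then show ?thesis
          using powR[OF powQ[OF that, of j]] nat_pow_pow[of x j p] that by (simp add: mult.commute)
      qed
      \<comment> \<open>\<open>K\<close> is the kernel of the e-th power endomorphism of
        \<open>Q\<close>. It contains every displacement, since e-th powers lie in \<open>R\<close>
        and are fixed by \<alpha>.\<close>
      define K where "K = {x \<in> Q. x [^] Cp_exponent = \<one>}"
      have "subgroup K G"
        by unfold_locales (auto simp: K_def powe_mult nat_pow_inv)
      moreover have "\<alpha> ` K \<subseteq> K"
        by (auto simp: K_def \<alpha>Q QP \<alpha>_pow[symmetric] \<alpha>_one)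
      moreover have "inv x \<otimes> \<alpha> x \<in> K" if x: "x \<in> Q" for x
      proof -
        have "(inv x \<otimes> \<alpha> x) [^] Cp_exponent = inv (x [^] Cp_exponent) \<otimes> \<alpha> (x [^] Cp_exponent)"
          using x by (simp add: powe_mult \<alpha>Q nat_pow_inv \<alpha>_pow QP)
        also have "\<dots> = \<one>" using x fixR[OF poweR[OF x]] by simp
        finally show ?thesis using x by (simp add: K_def \<alpha>Q)
      qed
      ultimately have "K = Q" by (intro absorb) (auto simp: K_def)
      then have CpQ: "Cp_element G p x" if "x \<in> Q" for x
        using that by (auto simp: K_def Cp_element_iff)
      \<comment> \<open>Now the hypothesis covers all of \<open>Q\<close>: \<alpha> x is a conjugate
        of x in \<open>G\<close>, so this product is a commutator of an element of \<open>G\<close>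
        with one of \<open>Q\<close>.\<close>
      have displ: "\<alpha> x \<otimes> inv x \<in> N" if x: "x \<in> Q" for x
        using conj[OF QP[OF x] CpQ[OF x]] Ncomm[OF x] by force
      have "subgroup (Q \<inter> N) G"
        using less.prems(1) N.subgroup_axioms by (rule subgroups_Inter_pair)
      moreover have "\<alpha> ` (Q \<inter> N) \<subseteq> Q \<inter> N"
      proof clarify
        fix x assume x: "x \<in> Q" "x \<in> N"
        then obtain s where "s \<in> carrier G" "\<alpha> x = s \<otimes> x \<otimes> inv s"
          using conj[OF QP CpQ] by blast
        then show "\<alpha> x \<in> Q \<inter> N" using x \<alpha>Q[OF x(1)] N.inv_op_closed2[of s x] by simp
      qed
      moreover have "inv x \<otimes> \<alpha> x \<in> Q \<inter> N" if x: "x \<in> Q" for x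
      proof -
        \<comment> \<open>Conjugation by x, under which \<open>N\<close> is stable, turns the
          right-hand displacement into the left-hand one required by \<open>absorb\<close>.\<close>
        have "inv x \<otimes> (\<alpha> x \<otimes> inv x) \<otimes> x \<in> N"
          using N.inv_op_closed1[OF _ displ[OF x]] x by simp
        then show ?thesis using x \<alpha>Q by (simp add: m_assoc)
      qed
      ultimately have "Q \<inter> N = Q" by (intro absorb) auto
      then show False using QN by blast
    qed
  qed
  then show ?thesis using P x \<alpha>_closed by blast
qed

end

section \<open>Saturated fusion systems\<close>

lemma eq_prime_power_if_only_prime_divisor:
  fixes p m :: nat
  assumes p: "Factorial_Ring.prime p" and "m \<noteq> 0"
    and only: "\<And>q. Factorial_Ring.prime q \<Longrightarrow> q dvd m \<Longrightarrow> q = p"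
  shows "m = p ^ multiplicity p m"
proof -
  obtain y where y: "m = p ^ multiplicity p m * y" "\<not> p dvd y"
    using multiplicity_decompose'[of m p] p assms(2) not_prime_unit by blast
  have "y = 1"
  proof (rule ccontr)
    assume "y \<noteq> 1"
    then obtain q where q: "Factorial_Ring.prime q" "q dvd y" using prime_factor_nat by blast
    then have "q dvd m" using y(1) by (metis dvd_mult)
    then show False using only q y(2) by blast
  qed
  then show ?thesis using y(1) by simp
qed

locale saturated_fusion_system = finite_p_group +
  fixes F :: "'a set \<Rightarrow> 'a set \<Rightarrow> ('a \<Rightarrow> 'a) set"
  assumes saturated: "saturated G p F"
begin

section \<open>Morphisms and conjugacy in a fusion system\<close>

lemma fusion: "fusion_system G F"
  using saturated by (simp add: saturated_def)

lemma HomS_subset: "subgroup P G \<Longrightarrow> subgroup Q G \<Longrightarrow> HomS G P Q \<subseteq> F P Q"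
  and F_Inj_hom: "\<phi> \<in> F P Q \<Longrightarrow> subgroup P G \<Longrightarrow> subgroup Q G \<Longrightarrow> \<phi> \<in> Inj_hom G P Q"
  and F_compose: "\<phi> \<in> F P Q \<Longrightarrow> \<psi> \<in> F Q R \<Longrightarrow> subgroup P G \<Longrightarrow> subgroup Q G \<Longrightarrow> subgroup R G
    \<Longrightarrow> compose P \<psi> \<phi> \<in> F P R"
  and F_image: "\<phi> \<in> F P Q \<Longrightarrow> subgroup P G \<Longrightarrow> subgroup Q G \<Longrightarrow> \<phi> \<in> F P (\<phi> ` P)"
  and F_inverse: "\<phi> \<in> F P Q \<Longrightarrow> subgroup P G \<Longrightarrow> subgroup Q G
    \<Longrightarrow> (\<lambda>y\<in>\<phi> ` P. the_inv_into P \<phi> y) \<in> F (\<phi> ` P) P"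
  using fusion unfolding fusion_system_def by blast+

lemma F_extensional: "\<phi> \<in> F P Q \<Longrightarrow> subgroup P G \<Longrightarrow> subgroup Q G \<Longrightarrow> \<phi> \<in> extensional P"
  and F_closed: "\<phi> \<in> F P Q \<Longrightarrow> subgroup P G \<Longrightarrow> subgroup Q G \<Longrightarrow> x \<in> P \<Longrightarrow> \<phi> x \<in> Q"
  and F_inj_on: "\<phi> \<in> F P Q \<Longrightarrow> subgroup P G \<Longrightarrow> subgroup Q G \<Longrightarrow> inj_on \<phi> P"
  and F_mult: "\<phi> \<in> F P Q \<Longrightarrow> subgroup P G \<Longrightarrow> subgroup Q G \<Longrightarrow> x \<in> P \<Longrightarrow> y \<in> P
    \<Longrightarrow> \<phi> (x \<otimes> y) = \<phi> x \<otimes> \<phi> y"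
  using F_Inj_hom unfolding Inj_hom_def by blast+

lemma subgroup_finite: "subgroup P G \<Longrightarrow> finite P"
  using subgroup.subset finite_carrier finite_subset by blast

lemma inclusion_in_F:
  assumes "subgroup P G" "subgroup Q G" "P \<subseteq> Q"
  shows "(\<lambda>x\<in>P. x) \<in> F P Q"
proof -
  have PG: "P \<subseteq> carrier G" using subgroup.subset assms by blast
  then have "conj_map G \<one> P = (\<lambda>x\<in>P. x)"
    by (auto simp: conj_map_def intro!: restrict_ext)
  moreover have "conj_map G \<one> P \<in> HomS G P Q"
    unfolding HomS_def
  proof (intro CollectI exI conjI)
    show "(\<lambda>x. \<one> \<otimes> x \<otimes> inv \<one>) ` P \<subseteq> Q" using PG assms(3) by (auto simp: subset_iff)
  qed (rule refl one_closed)+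
  ultimately have "(\<lambda>x\<in>P. x) \<in> HomS G P Q" by simp
  then show ?thesis using HomS_subset assms by blast
qed

lemma F_mono:
  assumes "\<phi> \<in> F P Q" "subgroup P G" "subgroup Q G" "subgroup R G" "Q \<subseteq> R"
  shows "\<phi> \<in> F P R"
proof -
  have "compose P (\<lambda>x\<in>Q. x) \<phi> = \<phi>"
    using F_closed[OF assms(1-3)] F_extensional[OF assms(1-3)]
    by (intro extensionalityI[of _ P]) (auto simp: compose_def)
  then show ?thesis using F_compose[OF assms(1) inclusion_in_F[OF assms(3-5)] assms(2-4)] by simp
qed

lemma F_restrict:
  assumes "\<phi> \<in> F P Q" "subgroup P G" "subgroup Q G" "subgroup R G" "R \<subseteq> P"
  shows "restrict \<phi> R \<in> F R Q"
proof -
  have "compose R \<phi> (\<lambda>x\<in>R. x) = restrict \<phi> R"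
    by (auto simp: compose_def intro!: restrict_ext)
  then show ?thesis
    using F_compose[OF inclusion_in_F[OF assms(4,2,5)] assms(1) assms(4,2,3)] by simp
qed

lemma F_image_subgroup:
  assumes "\<phi> \<in> F P Q" "subgroup P G" "subgroup Q G"
  shows "subgroup (\<phi> ` P) G"
proof -
  interpret P: group "G\<lparr>carrier := P\<rparr>" by (rule subgroup_imp_group[OF assms(2)])
  have "group_hom (G\<lparr>carrier := P\<rparr>) G \<phi>"
    using F_closed[OF assms] F_mult[OF assms] subgroup.subset[OF assms(3)]
    by (auto simp: group_hom_def group_hom_axioms_def hom_def P.is_group is_group)
  then show ?thesis using group_hom.img_is_subgroup by fastforce
qed

text \<open>A morphism is an isomorphism onto its image with inverse in \<open>F\<close>, so the
  conjugates of \<open>P\<close> are exactly the images of morphisms from \<open>P\<close> to the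
  whole group.\<close>

lemma F_conjugate_iff:
  assumes P: "subgroup P G"
  shows "F_conjugate G F P P' \<longleftrightarrow> (\<exists>\<phi>\<in>F P (carrier G). \<phi> ` P = P')"
proof
  assume "F_conjugate G F P P'"
  then obtain \<phi> \<psi> where P': "subgroup P' G" and \<phi>: "\<phi> \<in> F P P'" and \<psi>: "\<psi> \<in> F P' P"
    and eq: "compose P' \<phi> \<psi> = (\<lambda>x\<in>P'. x)"
    by (auto simp: F_conjugate_def F_iso_def)
  have "y \<in> \<phi> ` P" if "y \<in> P'" for y
    using fun_cong[OF eq, of y] that F_closed[OF \<psi> P' P that] by (auto simp: compose_def intro: rev_image_eqI)
  then have "\<phi> ` P = P'" using F_closed[OF \<phi> P P'] by auto
  then show "\<exists>\<phi>\<in>F P (carrier G). \<phi> ` P = P'"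
    using F_mono[OF \<phi> P P' subgroup_self subgroup.subset[OF P']] by blast
next
  assume "\<exists>\<phi>\<in>F P (carrier G). \<phi> ` P = P'"
  then obtain \<phi> where \<phi>: "\<phi> \<in> F P (carrier G)" and P': "P' = \<phi> ` P" by blast
  have inj: "inj_on \<phi> P" using F_inj_on[OF \<phi> P subgroup_self] .
  let ?\<psi> = "\<lambda>y\<in>P'. the_inv_into P \<phi> y"
  have "compose P ?\<psi> \<phi> = (\<lambda>x\<in>P. x)"
    by (auto simp: compose_def P' the_inv_into_f_f[OF inj] intro!: restrict_ext)
  moreover have "compose P' \<phi> ?\<psi> = (\<lambda>x\<in>P'. x)"
    by (auto simp: compose_def P' the_inv_into_f_f[OF inj] intro!: restrict_ext)
  ultimately show "F_conjugate G F P P'"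
    using F_image[OF \<phi> P subgroup_self] F_inverse[OF \<phi> P subgroup_self]
      F_image_subgroup[OF \<phi> P subgroup_self] P
    unfolding F_conjugate_def F_iso_def P' by blast
qed

lemma F_conjugate_trans:
  assumes "F_conjugate G F P Q" "F_conjugate G F Q R"
  shows "F_conjugate G F P R"
proof -
  have P: "subgroup P G" and Q: "subgroup Q G" using assms by (auto simp: F_conjugate_def)
  obtain \<phi> where \<phi>: "\<phi> \<in> F P (carrier G)" "\<phi> ` P = Q" using assms(1) F_conjugate_iff[OF P] by blast
  obtain \<psi> where \<psi>: "\<psi> \<in> F Q (carrier G)" "\<psi> ` Q = R" using assms(2) F_conjugate_iff[OF Q] by blast
  have "\<phi> \<in> F P Q" using F_image[OF \<phi>(1) P subgroup_self] \<phi>(2) by simp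
  then have "compose P \<psi> \<phi> \<in> F P (carrier G)" using F_compose \<psi>(1) P Q subgroup_self by blast
  moreover have "compose P \<psi> \<phi> ` P = R" using \<phi>(2) \<psi>(2) by (auto simp: compose_def)
  ultimately show ?thesis using F_conjugate_iff[OF P] by blast
qed

lemma ex_fully_normalized_conjugate:
  assumes P: "subgroup P G"
  obtains Q where "F_conjugate G F P Q" "fully_normalized G F Q"
proof -
  let ?A = "{Q. F_conjugate G F P Q}"
  have "finite ?A"
    by (rule finite_subset[of _ "Pow (carrier G)"])
      (auto simp: finite_carrier F_conjugate_def dest: subgroup.subset)
  moreover have "P \<in> ?A"
    using F_conjugate_iff[OF P] inclusion_in_F[OF P subgroup_self subgroup.subset[OF P]]
    by (auto intro!: bexI[of _ "\<lambda>x\<in>P. x"])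
  ultimately have fin: "finite ((\<lambda>R. card (normalizer G R)) ` ?A)"
    and ne: "(\<lambda>R. card (normalizer G R)) ` ?A \<noteq> {}"
    by blast+
  from Max_in[OF this]
  obtain Q where Q: "Q \<in> ?A"
    and max: "Max ((\<lambda>R. card (normalizer G R)) ` ?A) = card (normalizer G Q)"
    by (elim imageE)
  have "card (normalizer G R) \<le> card (normalizer G Q)" if "R \<in> ?A" for R
    unfolding max[symmetric] using that fin by (intro Max_ge) auto
  \<comment> \<open>The maximum was taken over conjugates of \<open>P\<close>; by transitivity these
    include all conjugates of \<open>Q\<close>.\<close>
  then have "fully_normalized G F Q"
    unfolding fully_normalized_def using Q F_conjugate_trans by blast
  with Q that show thesis by blast
qed

section \<open>The automorphism groups in F\<close>

lemma AutF_group: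
  assumes P: "subgroup P G"
  shows "group (AutF_group F P)"
proof (rule groupI)
  show "x \<otimes>\<^bsub>AutF_group F P\<^esub> y \<in> carrier (AutF_group F P)"
    if "x \<in> carrier (AutF_group F P)" "y \<in> carrier (AutF_group F P)" for x y
    using that F_compose P by (simp add: AutF_group_def)
  show "\<one>\<^bsub>AutF_group F P\<^esub> \<in> carrier (AutF_group F P)"
    using inclusion_in_F[OF P P] by (simp add: AutF_group_def)
  show "x \<otimes>\<^bsub>AutF_group F P\<^esub> y \<otimes>\<^bsub>AutF_group F P\<^esub> z = x \<otimes>\<^bsub>AutF_group F P\<^esub> (y \<otimes>\<^bsub>AutF_group F P\<^esub> z)"
    if "x \<in> carrier (AutF_group F P)" "y \<in> carrier (AutF_group F P)" "z \<in> carrier (AutF_group F P)"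
    for x y z
    using that F_closed[OF _ P P] by (auto simp: AutF_group_def compose_def intro!: restrict_ext)
  show "\<one>\<^bsub>AutF_group F P\<^esub> \<otimes>\<^bsub>AutF_group F P\<^esub> x = x" if "x \<in> carrier (AutF_group F P)" for x
    using that F_closed[OF _ P P] F_extensional[OF _ P P]
    by (intro extensionalityI[of _ P]) (auto simp: AutF_group_def compose_def)
  show "\<exists>y\<in>carrier (AutF_group F P). y \<otimes>\<^bsub>AutF_group F P\<^esub> x = \<one>\<^bsub>AutF_group F P\<^esub>"
    if "x \<in> carrier (AutF_group F P)" for x
  proof -
    have x: "x \<in> F P P" using that by (simp add: AutF_group_def)
    have inj: "inj_on x P" using F_inj_on[OF x P P] .
    have img: "x ` P = P"
      using endo_inj_surj[OF subgroup_finite[OF P] _ inj] F_closed[OF x P P] by blast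
    have "compose P (\<lambda>y\<in>P. the_inv_into P x y) x = (\<lambda>x\<in>P. x)"
      using F_closed[OF x P P] by (auto simp: compose_def the_inv_into_f_f[OF inj] intro!: restrict_ext)
    then show ?thesis
      using F_inverse[OF x P P] img by (auto simp: AutF_group_def intro!: bexI[of _ "\<lambda>y\<in>P. the_inv_into P x y"])
  qed
qed

text \<open>Translates powers in the automorphism group into the function iterates in which
  \<open>coprime_endomorphism\<close> is phrased.\<close>

lemma AutF_pow_apply:
  assumes P: "subgroup P G" and \<phi>: "\<phi> \<in> F P P" and x: "x \<in> P"
  shows "(\<phi> [^]\<^bsub>AutF_group F P\<^esub> (k::nat)) x = (\<phi> ^^ k) x"
  using x
proof (induction k arbitrary: x)
  case (Suc k)
  then have "(\<phi> [^]\<^bsub>AutF_group F P\<^esub> Suc k) x = (\<phi> [^]\<^bsub>AutF_group F P\<^esub> k) (\<phi> x)"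
    by (simp add: nat_pow_Suc AutF_group_def compose_def)
  also have "\<dots> = (\<phi> ^^ Suc k) x"
    using Suc F_closed[OF \<phi> P P] by (simp add: funpow_swap1)
  finally show ?case .
qed (simp add: AutF_group_def)

lemma finite_F:
  assumes "subgroup P G"
  shows "finite (F P P)"
proof (rule finite_subset)
  show "F P P \<subseteq> P \<rightarrow>\<^sub>E P"
    using F_extensional[OF _ assms assms] F_closed[OF _ assms assms] by (auto simp: PiE_def)
  show "finite (P \<rightarrow>\<^sub>E P)" using subgroup_finite[OF assms] by (intro finite_PiE) auto
qed

section \<open>Consequences of controlled fusion of C_p-subgroups\<close>

context
  assumes controls: "controls_Cp_fusion G p F"
begin

text \<open>For a C_p-element x of \<open>P\<close>, control of fusion on the subgroup generated by
  x makes \<phi> x a conjugate of x. The conjugating element may vary with x, which is all that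
  \<open>trivial_if_conj_on_Cp_elements\<close> asks for.\<close>

lemma coprime_period_trivial:
  assumes P: "subgroup P G" and \<phi>: "\<phi> \<in> F P P"
    and n: "\<phi> [^]\<^bsub>AutF_group F P\<^esub> n = \<one>\<^bsub>AutF_group F P\<^esub>" "coprime n p"
  shows "\<phi> = (\<lambda>x\<in>P. x)"
proof -
  interpret coprime_endomorphism G p P \<phi> n
  proof (intro coprime_endomorphism.intro coprime_endomorphism_axioms.intro)
    show "finite_p_group G p" by (rule finite_p_group_axioms)
    show "(\<phi> ^^ n) x = x" if "x \<in> P" for x
      using AutF_pow_apply[OF P \<phi> that, of n] n(1) that by (simp add: AutF_group_def)
    show "\<phi> (x \<otimes> y) = \<phi> x \<otimes> \<phi> y" if "x \<in> P" "y \<in> P" for x y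
      using F_mult[OF \<phi> P P that] .
    show "\<phi> x \<in> P" if "x \<in> P" for x
      using F_closed[OF \<phi> P P that] .
  qed (rule P n(2))+
  have "\<exists>s\<in>carrier G. \<phi> x = s \<otimes> x \<otimes> inv s" if x: "x \<in> P" and Cp: "Cp_element G p x" for x
  proof -
    let ?C = "generate G {x}"
    have C: "subgroup ?C G" using x P_carrier by (intro generate_is_subgroup) auto
    have CP: "?C \<subseteq> P" using x P by (intro generate_subgroup_incl) auto
    have xC: "x \<in> ?C" by (auto intro: generate.incl)
    have "restrict \<phi> ?C \<in> F ?C (carrier G)"
      using F_mono[OF F_restrict[OF \<phi> P P C CP] C P subgroup_self subgroup.subset[OF P]] .
    moreover have "Cp_subgroup G p ?C" using Cp by (auto simp: Cp_subgroup_def)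
    ultimately show ?thesis using controls xC unfolding controls_Cp_fusion_def
      by (metis restrict_apply')
  qed
  then have "\<phi> x = x" if "x \<in> P" for x using trivial_if_conj_on_Cp_elements that by blast
  then show ?thesis
    using F_extensional[OF \<phi> P P] by (intro extensionalityI[of _ P]) auto
qed

text \<open>For another prime q, an element of order q would be an automorphism of period prime to
  p, hence the identity.\<close>

lemma prime_dvd_card_AutF:
  assumes P: "subgroup P G" and q: "Factorial_Ring.prime q" "q dvd card (F P P)"
  shows "q = p"
proof (rule ccontr)
  assume "q \<noteq> p"
  let ?A = "AutF_group F P"
  interpret A: group ?A by (rule AutF_group[OF P])
  have cA: "carrier ?A = F P P" by (simp add: AutF_group_def)
  obtain m where m: "card (F P P) = q * m" using q(2) by (elim dvdE)
  \<comment> \<open>Cauchy's theorem, as the Sylow theorem with exponent 1.\<close>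
  obtain H where H: "subgroup H ?A" "card H = q ^ 1"
    using sylow_thm[of q ?A 1 m] q(1) A.is_group m finite_F[OF P] by (auto simp: order_def cA)
  interpret H: group "?A\<lparr>carrier := H\<rparr>" by (rule A.subgroup_imp_group[OF H(1)])
  have "H \<noteq> {\<one>\<^bsub>?A\<^esub>}" using H(2) q(1) by auto
  then obtain \<phi> where \<phi>: "\<phi> \<in> H" "\<phi> \<noteq> \<one>\<^bsub>?A\<^esub>" using subgroup.one_closed[OF H(1)] by blast
  have "\<phi> [^]\<^bsub>?A\<^esub> q = \<one>\<^bsub>?A\<^esub>"
    using H.pow_order_eq_1[of \<phi>] \<phi>(1) H(2) by (simp add: order_def A.nat_pow_consistent[symmetric])
  moreover have "coprime q p" using primes_coprime[OF q(1) prime_p \<open>q \<noteq> p\<close>] .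
  moreover have "\<phi> \<in> F P P" using \<phi>(1) subgroup.subset[OF H(1)] cA by blast
  ultimately have "\<phi> = (\<lambda>x\<in>P. x)" using coprime_period_trivial[OF P] by blast
  with \<phi>(2) show False by (simp add: AutF_group_def)
qed

text \<open>The automorphism group has p-power order, so its Sylow p-subgroup of conjugations is
  everything.\<close>

lemma AutF_eq_AutS:
  assumes P: "subgroup P G" and "fully_normalized G F P"
  shows "F P P = HomS G P P"
proof -
  have "sylow_subgroup p (HomS G P P) (AutF_group F P)"
    using saturated assms by (simp add: saturated_def)
  then have "card (HomS G P P) = p ^ multiplicity p (card (F P P))"
    by (simp add: sylow_subgroup_def AutF_group_def)
  moreover have "card (F P P) \<noteq> 0" using finite_F[OF P] inclusion_in_F[OF P P] by auto
  then have "card (F P P) = p ^ multiplicity p (card (F P P))"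
    using eq_prime_power_if_only_prime_divisor[OF prime_p] prime_dvd_card_AutF[OF P] by blast
  ultimately show ?thesis
    using card_subset_eq[OF finite_F[OF P] HomS_subset[OF P P]] by simp
qed

text \<open>Transporting conjugation by g along \<phi> gives an \<open>F\<close>-automorphism of the
  image. As the image is fully normalized, \<open>AutF_eq_AutS\<close> makes this a conjugation, so
  g satisfies the extension condition.\<close>

lemma N_phi_eq_normalizer:
  assumes P: "subgroup P G" and \<phi>: "\<phi> \<in> F P (carrier G)"
    and fn: "fully_normalized G F (\<phi> ` P)"
  shows "N_phi G P \<phi> = normalizer G P"
proof -
  let ?Q = "\<phi> ` P"
  have Q: "subgroup ?Q G" using F_image_subgroup[OF \<phi> P subgroup_self] .
  have \<phi>Q: "\<phi> \<in> F P ?Q" using F_image[OF \<phi> P subgroup_self] .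
  have inj: "inj_on \<phi> P" using F_inj_on[OF \<phi> P subgroup_self] .
  have inv: "(\<lambda>y\<in>?Q. the_inv_into P \<phi> y) \<in> F ?Q P" using F_inverse[OF \<phi> P subgroup_self] .
  have "\<exists>h\<in>normalizer G ?Q. \<forall>x\<in>P. \<phi> (g \<otimes> x \<otimes> inv g) = h \<otimes> \<phi> x \<otimes> inv h"
    if "g \<in> normalizer G P" for g
  proof -
    have g: "g \<in> carrier G" "(\<lambda>x. g \<otimes> x \<otimes> inv g) ` P = P"
      using that mem_normalizer_iff[OF P] by auto
    then have "conj_map G g P \<in> HomS G P P" unfolding HomS_def by auto
    then have "conj_map G g P \<in> F P P" using HomS_subset[OF P P] by blast
    then have "compose ?Q (compose P \<phi> (conj_map G g P)) (\<lambda>y\<in>?Q. the_inv_into P \<phi> y) \<in> F ?Q ?Q"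
      by (intro F_compose[OF inv] F_compose[OF _ \<phi>Q] P Q)
    then obtain h where h: "h \<in> carrier G" "(\<lambda>x. h \<otimes> x \<otimes> inv h) ` ?Q \<subseteq> ?Q"
      and eq: "compose ?Q (compose P \<phi> (conj_map G g P)) (\<lambda>y\<in>?Q. the_inv_into P \<phi> y) = conj_map G h ?Q"
      using AutF_eq_AutS[OF Q fn] unfolding HomS_def by auto
    have "h \<in> normalizer G ?Q"
      using mem_normalizer_iff[OF Q] conj_image_eqI[OF Q h(1)] h by blast
    moreover have "\<phi> (g \<otimes> x \<otimes> inv g) = h \<otimes> \<phi> x \<otimes> inv h" if x: "x \<in> P" for x
      using fun_cong[OF eq, of "\<phi> x"] x by (simp add: compose_def conj_map_def the_inv_into_f_f[OF inj])
    ultimately show ?thesis by blast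
  qed
  then show ?thesis by (auto simp: N_phi_def)
qed

text \<open>Induction on |G| - |P|. Morphisms onto fully normalized subgroups extend to the strictly
  larger normalizer, where the induction hypothesis applies. An arbitrary morphism is compared with
  one onto a fully normalized conjugate of \<open>P\<close>.\<close>

lemma F_is_conjugation:
  assumes "subgroup P G" "\<phi> \<in> F P (carrier G)"
  shows "\<exists>s\<in>carrier G. \<forall>x\<in>P. \<phi> x = s \<otimes> x \<otimes> inv s"
  using assms
proof (induction "card (carrier G) - card P" arbitrary: P \<phi> rule: less_induct)
  case less
  \<comment> \<open>Stated for every \<open>R\<close> of the same order as \<open>P\<close>, because
    it is used for both \<open>P\<close> and its image under \<phi>.\<close>
  have onto_fully_normalized: "\<exists>s\<in>carrier G. \<forall>x\<in>R. \<psi> x = s \<otimes> x \<otimes> inv s"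
    if R: "subgroup R G" and cR: "card R = card P" and \<psi>: "\<psi> \<in> F R (carrier G)"
      and fn: "fully_normalized G F (\<psi> ` R)" for R \<psi>
  proof (cases "R = carrier G")
    case True
    \<comment> \<open>The normalizer cannot grow here, but \<psi> is an automorphism of the whole
      group, so \<open>AutF_eq_AutS\<close> applies directly.\<close>
    have "\<psi> ` R = R"
      using endo_inj_surj[OF subgroup_finite[OF R] _ F_inj_on[OF \<psi> R subgroup_self]]
        F_closed[OF \<psi> R subgroup_self] True by blast
    then have "\<psi> \<in> HomS G R R" using AutF_eq_AutS[OF R] fn \<psi> True by simp
    then show ?thesis by (auto simp: HomS_def conj_map_def)
  next
    case False
    let ?N = "normalizer G R"
    have N: "subgroup ?N G" using normalizer_imp_subgroup[OF subgroup.subset[OF R]] .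
    have RN: "R \<subset> ?N" using subgroup_psubset_normalizer[OF R False] .
    have "card R < card ?N" using psubset_card_mono[OF subgroup_finite[OF N] RN] .
    moreover have "card ?N \<le> card (carrier G)"
      using card_mono[OF finite_carrier subgroup.subset[OF N]] .
    ultimately have lt: "card (carrier G) - card ?N < card (carrier G) - card P" using cR by linarith
    have "fully_centralized G F (\<psi> ` R)"
      using saturated fn F_image_subgroup[OF \<psi> R subgroup_self] by (simp add: saturated_def)
    then have "\<exists>\<chi>\<in>F ?N (carrier G). \<forall>x\<in>R. \<chi> x = \<psi> x"
      using saturated R \<psi> N_phi_eq_normalizer[OF R \<psi> fn] unfolding saturated_def by metis
    then obtain \<chi> where \<chi>: "\<chi> \<in> F ?N (carrier G)" "\<forall>x\<in>R. \<chi> x = \<psi> x" by blast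
    then obtain s where s: "s \<in> carrier G" "\<forall>x\<in>?N. \<chi> x = s \<otimes> x \<otimes> inv s"
      using less.hyps[OF lt N] by blast
    have "\<psi> x = s \<otimes> x \<otimes> inv s" if x: "x \<in> R" for x
    proof -
      have "x \<in> ?N" using x RN by blast
      with s(2) have "\<chi> x = s \<otimes> x \<otimes> inv s" by (rule bspec)
      then show ?thesis using bspec[OF \<chi>(2) x] by simp
    qed
    with s(1) show ?thesis by blast
  qed
  note P = less.prems(1) and \<phi> = less.prems(2)
  obtain Q where Q: "F_conjugate G F P Q" and fn: "fully_normalized G F Q"
    using ex_fully_normalized_conjugate[OF P] .
  obtain \<psi> where \<psi>: "\<psi> \<in> F P (carrier G)" "\<psi> ` P = Q"
    using Q F_conjugate_iff[OF P] by blast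
  obtain s where s: "s \<in> carrier G" "\<And>x. x \<in> P \<Longrightarrow> \<psi> x = s \<otimes> x \<otimes> inv s"
    using onto_fully_normalized[OF P refl \<psi>(1)] \<psi>(2) fn by blast
  let ?R = "\<phi> ` P"
  \<comment> \<open>This is \<psi> after the inverse of \<phi>, again onto the fully normalized
    \<open>Q\<close>. If \<psi> is conjugation by s and this map conjugation by t, then \<phi> is
    conjugation by the inverse of t times s.\<close>
  let ?\<chi> = "compose ?R \<psi> (\<lambda>y\<in>?R. the_inv_into P \<phi> y)"
  have inj: "inj_on \<phi> P" using F_inj_on[OF \<phi> P subgroup_self] .
  have R: "subgroup ?R G" using F_image_subgroup[OF \<phi> P subgroup_self] .
  have "?\<chi> \<in> F ?R (carrier G)"
    using F_compose[OF F_inverse[OF \<phi> P subgroup_self] \<psi>(1) R P subgroup_self] .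
  moreover have \<chi>_apply: "?\<chi> (\<phi> x) = \<psi> x" if "x \<in> P" for x
    using that by (simp add: compose_def the_inv_into_f_f[OF inj])
  have "?\<chi> ` ?R = Q" using \<chi>_apply \<psi>(2) by (simp add: image_image)
  ultimately obtain t where t: "t \<in> carrier G" "\<And>y. y \<in> ?R \<Longrightarrow> ?\<chi> y = t \<otimes> y \<otimes> inv t"
    using onto_fully_normalized[OF R card_image[OF inj], of ?\<chi>] fn by metis
  have "\<phi> x = (inv t \<otimes> s) \<otimes> x \<otimes> inv (inv t \<otimes> s)" if x: "x \<in> P" for x
  proof -
    have xG: "x \<in> carrier G" using x subgroup.subset[OF P] by blast
    have \<phi>x: "\<phi> x \<in> carrier G" using F_closed[OF \<phi> P subgroup_self x] .
    have "s \<otimes> x \<otimes> inv s = t \<otimes> \<phi> x \<otimes> inv t" using t(2)[of "\<phi> x"] \<chi>_apply s(2) x by simp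
    then have "inv t \<otimes> (s \<otimes> x \<otimes> inv s) \<otimes> t = inv t \<otimes> (t \<otimes> \<phi> x \<otimes> inv t) \<otimes> t" by simp
    also have "\<dots> = (inv t \<otimes> t) \<otimes> \<phi> x \<otimes> (inv t \<otimes> t)" using t(1) \<phi>x by (simp only: m_assoc m_closed inv_closed)
    also have "\<dots> = \<phi> x" using t(1) \<phi>x by simp
    finally show ?thesis using t(1) s(1) xG by (simp add: m_assoc inv_mult_group)
  qed
  then show ?case using t(1) s(1) by (intro bexI[of _ "inv t \<otimes> s"]) auto
qed

end

section \<open>The two implications\<close>

lemma nilpotent_if_controls_Cp_fusion:
  assumes "controls_Cp_fusion G p F"
  shows "nilpotent_fusion G F"
proof -
  have "\<phi> \<in> HomS G P Q" if P: "subgroup P G" and Q: "subgroup Q G" and \<phi>: "\<phi> \<in> F P Q" for P Q \<phi>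
  proof -
    obtain s where s: "s \<in> carrier G" "\<And>x. x \<in> P \<Longrightarrow> \<phi> x = s \<otimes> x \<otimes> inv s"
      using F_is_conjugation[OF assms P] F_mono[OF \<phi> P Q subgroup_self subgroup.subset[OF Q]] by blast
    have "\<phi> = conj_map G s P"
      using F_extensional[OF \<phi> P Q] s(2)
      by (intro extensionalityI[of _ P]) (auto simp: conj_map_def)
    moreover have "(\<lambda>x. s \<otimes> x \<otimes> inv s) ` P \<subseteq> Q" using F_closed[OF \<phi> P Q] s(2) by auto
    ultimately show ?thesis using s(1) unfolding HomS_def by blast
  qed
  then show ?thesis unfolding nilpotent_fusion_def using HomS_subset by blast
qed

lemma controls_Cp_fusion_if_nilpotent:
  assumes "nilpotent_fusion G F"
  shows "controls_Cp_fusion G p F"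
  unfolding controls_Cp_fusion_def
proof (intro allI impI ballI)
  fix P f assume P: "Cp_subgroup G p P" and f: "f \<in> F P (carrier G)"
  have "subgroup P G"
    using P by (auto simp: Cp_subgroup_def Cp_element_def intro: generate_is_subgroup)
  then have "f \<in> HomS G P (carrier G)"
    using f assms subgroup_self by (auto simp: nilpotent_fusion_def)
  then show "\<exists>s\<in>carrier G. \<forall>x\<in>P. f x = s \<otimes> x \<otimes> inv s"
    by (auto simp: HomS_def conj_map_def)
qed

end

theorem theorem7p4:
  fixes S :: "('a, 'b) monoid_scheme" and p :: nat
    and F :: "'a set \<Rightarrow> 'a set \<Rightarrow> ('a \<Rightarrow> 'a) set"
    and Mor :: "'a set \<Rightarrow> 'a set \<Rightarrow> 'm set" and cmp :: "'m \<Rightarrow> 'm \<Rightarrow> 'm"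
    and idL :: "'a set \<Rightarrow> 'm" and \<pi> :: "'a set \<Rightarrow> 'a set \<Rightarrow> 'm \<Rightarrow> ('a \<Rightarrow> 'a)"
    and \<delta> :: "'a set \<Rightarrow> 'a \<Rightarrow> 'm"
  assumes "p_local_finite_group S p F Mor cmp idL \<pi> \<delta>"
  shows "nilpotent_fusion S F \<longleftrightarrow> controls_Cp_fusion S p F"
proof -
  have "p_group S p" and "saturated S p F"
    using assms by (auto simp: p_local_finite_group_def)
  then interpret saturated_fusion_system S p F
    by (simp add: saturated_fusion_system_def saturated_fusion_system_axioms_def
        finite_p_group_def finite_p_group_axioms_def p_group_def)
  show ?thesis
    using nilpotent_if_controls_Cp_fusion controls_Cp_fusion_if_nilpotent by blast
qed

end
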